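(* For all $\tau\in\mathbb{H}$, writing $u=u(\tau)$, $$j(2\tau) = \dfrac{(1+6u^2-2u^3)^3Q(u)^3}{u^2(1-2u)^9(1+u)^{18}(1-u+u^2)^2(1+2u+4u^2)},$$ where $$Q(X):=1+234X^2-6X^3+756X^4-936X^5+2172X^6-1512X^7+936X^8-8X^9.$$
   Context: $\mathbb{H}$ is the complex upper half-plane, $q=e^{2\pi i\tau}$ and $q^r=e^{2\pi i r\tau}$ for rational $r$, $\eta(\tau)=q^{1/24}\prod_{n=1}^\infty(1-q^n)$ is the Dedekind eta function, and $$u(\tau):=\dfrac{\eta(3\tau)\eta^3(18\tau)}{\eta(6\tau)\eta^3(9\tau)}.$$ The modular $j$-invariant is $$j(\tau)=\eta^{-24}(\tau)\left(1+240\sum_{n=1}^\infty\dfrac{n^3q^n}{1-q^n}\right)^3.$$ *)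

theory Defs
  imports "HOL-Analysis.Analysis"
begin

text \<open>
  The notions below are total functions on the complex numbers, but are only meaningful for
  arguments in the upper half-plane. Indices that start at 1 are shifted: the library's infinite
  products and sums range over all natural numbers, so \<open>Suc n\<close> plays the role of the index.
\<close>

definition nome_pow :: "real \<Rightarrow> complex \<Rightarrow> complex" where
  \<comment> \<open>\<open>q\<close> to the power \<open>r\<close>, i.e. \<open>exp (2 * pi * \<i> * r * \<tau>)\<close>; not defined via \<open>powr\<close>, whose
      principal branch would give a different value\<close>
  "nome_pow r \<tau> = exp (2 * of_real pi * \<i> * of_real r * \<tau>)"

abbreviation nome :: "complex \<Rightarrow> complex" where
  "nome \<equiv> nome_pow 1"

definition dedekind_eta :: "complex \<Rightarrow> complex" where
  "dedekind_eta \<tau> = nome_pow (1 / 24) \<tau> * (\<Prod>n. 1 - nome \<tau> ^ Suc n)"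

definition u_fun :: "complex \<Rightarrow> complex" where
  "u_fun \<tau> = (dedekind_eta (3 * \<tau>) * dedekind_eta (18 * \<tau>) ^ 3) /
             (dedekind_eta (6 * \<tau>) * dedekind_eta (9 * \<tau>) ^ 3)"

definition j_invariant :: "complex \<Rightarrow> complex" where
  "j_invariant \<tau> = dedekind_eta \<tau> powi (-24) *
     (1 + 240 * (\<Sum>n. of_nat (Suc n) ^ 3 * nome \<tau> ^ Suc n / (1 - nome \<tau> ^ Suc n))) ^ 3"

definition Q :: "complex \<Rightarrow> complex" where
  "Q X = 1 + 234 * X^2 - 6 * X^3 + 756 * X^4 - 936 * X^5 + 2172 * X^6
           - 1512 * X^7 + 936 * X^8 - 8 * X^9"

end

theory Submission
  imports Defs "HOL-Complex_Analysis.Complex_Analysis"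
begin

text \<open>
  Write \<open>q\<close> for the nome of \<open>\<tau>\<close> and \<open>E\<close> for Euler's product \<open>E(p) = \<Prod>n\<ge>1. 1 - p^n\<close>, and put
  \<open>h = (\<eta>(\<tau>) / \<eta>(2\<tau>))^24 = E(q)^24 / (q E(q^2)^24)\<close>. The theorem combines two facts about \<open>h\<close>:
  \<open>j(2\<tau>) = (h + 16)^3 / h\<close> and
  \<open>h = (1 - 2u)^8 (1 - 8u^3) / (u (1 + u)^8 (1 + u^3))\<close>. After these are substituted into each other,
  the formula for \<open>j(2\<tau>)\<close> is an identity between polynomials in \<open>u\<close>.

  The formula for \<open>h\<close> (\<open>eta_quotient_hauptmodul\<close>) comes from splitting theta series by the residue of the
  summation index modulo 3. With \<open>\<phi>(-q) = \<Sum>j. (-1)^j q^(j^2) = E(q)^2 / E(q^2)\<close> and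
  \<open>\<psi>(q) = \<Sum>j\<ge>0. q^(j(j+1)/2) = E(q^2)^2 / E(q)\<close>, one residue class of each series reproduces the same theta
  function at \<open>q^9\<close>, and Jacobi's triple product writes the remaining classes as eta quotients that
  involve \<open>u\<close>:
  \<open>\<phi>(-q) = \<phi>(-q^9) (1 - 2u)\<close> and \<open>\<psi>(q) = q \<psi>(q^9) (1 + 1/u)\<close>.
  Replacing \<open>q\<close> by \<open>\<omega>q\<close> with a cube root of unity \<open>\<omega>\<close> replaces \<open>u\<close> by \<open>\<omega>u\<close>, so multiplying the three
  conjugate identities yields \<open>1 - 8u^3\<close> and \<open>1 + u^3\<close> as eta quotients as well
  (\<open>hauptmodul_cubes\<close>). The eta factors at \<open>3\<tau>\<close>, \<open>6\<tau>\<close>, \<open>9\<tau>\<close>, \<open>18\<tau>\<close> then cancel in the formula for \<open>h\<close>.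

  The formula for \<open>j(2\<tau>)\<close> amounts to \<open>E4(q^2) = \<phi>(-q)^8 + 16 q \<psi>(q)^8\<close> (\<open>eisenstein4_eta\<close>), where \<open>E4\<close> is
  the Eisenstein series in the definition of \<open>j\<close>. Both eighth powers are Lambert series:
  \<open>\<phi>(-q)^8 = 1 + 16 \<Sum> (-1)^n n^3 q^n / (1 - q^n)\<close> and \<open>q \<psi>(q)^8 = \<Sum> n^3 q^n / (1 - q^(2n))\<close>, and
  the Eisenstein identity is a rearrangement of these. Each Lambert series is the second derivative of the
  Weierstrass function at a half period. That derivative is read off from the classical factorisation of a
  difference of two values of the Weierstrass function into theta functions (\<open>wp_difference\<close>), because
  at a half period the difference has a double zero. The factorisation itself is a form of Liouville's
  theorem: the two sides differ by a function that is holomorphic on an annulus and invariant under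
  multiplication by the period, so its modulus has an interior maximum and the function is constant.
\<close>

section \<open>The infinite q-Pochhammer symbol\<close>

definition qpoch :: "complex \<Rightarrow> complex \<Rightarrow> complex" where
  "qpoch x p = (\<Prod>n. 1 - x * p ^ n)"

lemma qpoch_convergent:
  fixes p x :: complex
  assumes "norm p < 1"
  shows "convergent_prod (\<lambda>n. 1 - x * p ^ n)"
proof -
  have "summable (\<lambda>n. norm x * norm p ^ n)"
    using assms by (intro summable_mult summable_geometric) auto
  hence "abs_convergent_prod (\<lambda>n. 1 - x * p ^ n)"
    by (simp add: abs_convergent_prod_conv_summable norm_mult norm_power)
  thus ?thesis by (rule abs_convergent_prod_imp_convergent_prod)
qed

lemma qpoch_LIMSEQ:
  assumes "norm p < 1"
  shows "(\<lambda>n. \<Prod>k<n. 1 - x * p ^ k) \<longlonglongrightarrow> qpoch x p"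
proof -
  have "(\<lambda>n. \<Prod>k\<le>n. 1 - x * p ^ k) \<longlonglongrightarrow> qpoch x p"
    unfolding qpoch_def using convergent_prod_LIMSEQ[OF qpoch_convergent[OF assms]] .
  thus ?thesis by (simp only: lessThan_Suc_atMost [symmetric] filterlim_sequentially_Suc[of "\<lambda>n. \<Prod>k<n. 1 - x * p ^ k"])
qed

lemma qpoch_unfold:
  assumes "norm p < 1"
  shows "qpoch x p = (1 - x) * qpoch (p * x) p"
proof -
  have "(\<lambda>n. (1 - x) * (\<Prod>k<n. 1 - p * x * p ^ k)) \<longlonglongrightarrow> (1 - x) * qpoch (p * x) p"
    by (intro tendsto_intros qpoch_LIMSEQ assms)
  also have "(\<lambda>n. (1 - x) * (\<Prod>k<n. 1 - p * x * p ^ k)) = (\<lambda>n. \<Prod>k<Suc n. 1 - x * p ^ k)"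
    by (simp only: prod.lessThan_Suc_shift) (simp add: mult_ac)
  finally show ?thesis
    using LIMSEQ_unique[OF LIMSEQ_Suc[OF qpoch_LIMSEQ[OF assms]]] by simp
qed

lemma qpoch_nonzero:
  assumes "norm p < 1" "norm x < 1"
  shows "qpoch x p \<noteq> 0"
  unfolding qpoch_def
proof (rule prodinf_nonzero[OF qpoch_convergent])
  fix n
  have "norm (x * p ^ n) < 1"
    using assms mult_strict_mono[of "norm x" 1 "norm p ^ n" "2"] power_le_one[of "norm p" n]
    by (smt (verit) mult_left_le norm_ge_zero norm_mult norm_power)
  thus "1 - x * p ^ n \<noteq> 0" by auto
qed (use assms in auto)

text \<open>
  Sorting the factors by the residue of the exponent modulo \<open>m\<close>. These splittings turn every product
  that comes out of the triple product into quotients of Euler products.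
\<close>
lemma qpoch_split:
  assumes "norm p < 1" "m > 0"
  shows "qpoch x p = (\<Prod>i<m. qpoch (x * p ^ i) (p ^ m))"
proof -
  have pm: "norm (p ^ m) < 1"
    using assms by (simp add: norm_power power_less_one_iff)
  have "(\<lambda>n. \<Prod>i<m. \<Prod>k<n. 1 - x * p ^ i * (p ^ m) ^ k) \<longlonglongrightarrow> (\<Prod>i<m. qpoch (x * p ^ i) (p ^ m))"
    by (intro tendsto_prod qpoch_LIMSEQ pm)
  also have "(\<lambda>n. \<Prod>i<m. \<Prod>k<n. 1 - x * p ^ i * (p ^ m) ^ k) = (\<lambda>n. \<Prod>k<n * m. 1 - x * p ^ k)"
  proof
    fix n
    have "(\<Prod>i<m. \<Prod>k<n. 1 - x * p ^ i * (p ^ m) ^ k) = (\<Prod>k<n. \<Prod>i<m. 1 - x * p ^ (i + k * m))"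
      by (subst prod.swap) (simp add: power_add power_mult mult_ac flip: power_mult)
    also have "\<dots> = (\<Prod>k<n. \<Prod>j=k*m..<k*m+m. 1 - x * p ^ j)"
    proof (rule prod.cong)
      fix k
      show "(\<Prod>i<m. 1 - x * p ^ (i + k * m)) = (\<Prod>j=k*m..<k*m+m. 1 - x * p ^ j)"
        by (rule prod.reindex_bij_witness[of _ "\<lambda>j. j - k*m" "\<lambda>i. i + k*m"]) auto
    qed auto
    finally show "(\<Prod>i<m. \<Prod>k<n. 1 - x * p ^ i * (p ^ m) ^ k) = (\<Prod>k<n * m. 1 - x * p ^ k)"
      by (simp add: prod.nat_group)
  qed
  finally have "(\<lambda>n. \<Prod>k<n * m. 1 - x * p ^ k) \<longlonglongrightarrow> (\<Prod>i<m. qpoch (x * p ^ i) (p ^ m))" .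
  moreover have "(\<lambda>n. \<Prod>k<n * m. 1 - x * p ^ k) \<longlonglongrightarrow> qpoch x p"
    by (rule filterlim_compose[OF qpoch_LIMSEQ[OF assms(1)]])
       (use assms(2) in \<open>auto intro!: filterlim_subseq simp: strict_mono_def\<close>)
  ultimately show ?thesis using LIMSEQ_unique by blast
qed

lemma qpoch_split2: "norm p < 1 \<Longrightarrow> qpoch x p = qpoch x (p^2) * qpoch (x * p) (p^2)"
  using qpoch_split[of p 2 x] by (simp add: numeral_2_eq_2)

lemma qpoch_split3:
  "norm p < 1 \<Longrightarrow> qpoch x p = qpoch x (p^3) * qpoch (x * p) (p^3) * qpoch (x * p^2) (p^3)"
  using qpoch_split[of p 3 x] by (simp add: eval_nat_numeral)

lemma qpoch_times_minus:
  assumes "norm p < 1"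
  shows "qpoch x p * qpoch (- x) p = qpoch (x^2) (p^2)"
  unfolding qpoch_def
  by (subst prodinf_mult[OF qpoch_convergent[OF assms] qpoch_convergent[OF assms]], rule prodinf_cong)
     (simp add: power2_eq_square algebra_simps flip: power_mult power_mult_distrib)

text \<open>
  Factorwise this is \<open>(1 - y) (1 - \<omega>y) (1 - \<omega>\<^sup>2y) = 1 - y\<^sup>3\<close>, where \<open>w\<close> is a primitive cube root of unity \<open>\<omega>\<close>.
\<close>
lemma qpoch_times_cube_roots:
  assumes "norm p < 1" "w^2 + w + 1 = 0"
  shows "qpoch x p * qpoch (w * x) p * qpoch (w^2 * x) p = qpoch (x^3) (p^3)"
proof -
  have *: "(1 - y) * (1 - w * y) * (1 - w^2 * y) = 1 - y ^ 3" for y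
    using assms(2) by algebra
  show ?thesis
    unfolding qpoch_def
    apply (subst prodinf_mult[OF qpoch_convergent[OF assms(1)] qpoch_convergent[OF assms(1)]])
    apply (subst prodinf_mult[OF convergent_prod_mult[OF qpoch_convergent[OF assms(1)] qpoch_convergent[OF assms(1)]] qpoch_convergent[OF assms(1)]])
    apply (rule prodinf_cong)
    subgoal for n using *[of "x * p ^ n"] by (simp add: mult.assoc power_mult_distrib power_commutes flip: power_mult) (simp add: mult.commute)
    done
qed

lemma qpoch_holomorphic:
  assumes "norm p < 1"
  shows "(\<lambda>x. qpoch x p) holomorphic_on A"
proof -
  have "(\<lambda>x. qpoch x p) holomorphic_on UNIV"
  proof (rule holomorphic_uniform_sequence[where f = "\<lambda>n x. \<Prod>k<n. 1 - x * p ^ k"])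
    fix x :: complex
    define R where "R = norm x + 1"
    have "uniformly_convergent_on (cball x 1) (\<lambda>N z. \<Prod>k<N. 1 + (- z * p ^ k))"
    proof (rule uniformly_convergent_on_prod)
      show "uniformly_convergent_on (cball x 1) (\<lambda>N z. \<Sum>n<N. norm (- z * p ^ n))"
      proof (rule Weierstrass_m_test')
        fix n z assume "z \<in> cball x 1"
        hence "norm z \<le> R"
          using norm_triangle_ineq2[of z x] by (simp add: R_def dist_norm norm_minus_commute)
        thus "norm (norm (- z * p ^ n)) \<le> R * norm p ^ n"
          by (simp add: norm_mult norm_power mult_right_mono)
        next
        show "summable (\<lambda>n. R * norm p ^ n)"
          using assms by (intro summable_mult summable_geometric) auto
      qed
    qed (auto intro!: continuous_intros)
    then obtain l where l: "uniform_limit (cball x 1) (\<lambda>N z. \<Prod>k<N. 1 + (- z * p ^ k)) l sequentially"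
      by (auto simp: uniformly_convergent_on_def)
    have "l z = qpoch z p" if "z \<in> cball x 1" for z
      using LIMSEQ_unique[OF tendsto_uniform_limitI[OF l that]] qpoch_LIMSEQ[OF assms, of z] by simp
    hence "uniform_limit (cball x 1) (\<lambda>N z. \<Prod>k<N. 1 + (- z * p ^ k)) l sequentially \<longleftrightarrow>
           uniform_limit (cball x 1) (\<lambda>N z. \<Prod>k<N. 1 - z * p ^ k) (\<lambda>z. qpoch z p) sequentially"
      by (intro uniform_limit_cong') auto
    with l have "uniform_limit (cball x 1) (\<lambda>N z. \<Prod>k<N. 1 - z * p ^ k) (\<lambda>z. qpoch z p) sequentially"
      by blast
    thus "\<exists>d>0. cball x d \<subseteq> UNIV \<and> uniform_limit (cball x d) (\<lambda>N z. \<Prod>k<N. 1 - z * p ^ k) (\<lambda>z. qpoch z p) sequentially"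
      by (intro exI[of _ 1]) auto
  qed (auto intro!: holomorphic_intros)
  thus ?thesis by (rule holomorphic_on_subset) auto
qed

section \<open>Jacobi's triple product\<close>

text \<open>
  The reciprocal of the finite product \<open>(p; p)\<^sub>k\<close>, extended by \<open>0\<close> to negative \<open>k\<close>. This is the extension
  for which the recurrence below holds at every integer, so that sums of \<open>q\<close>-binomial coefficients can
  range over all integers without boundary cases.
\<close>
definition recip_qfact :: "complex \<Rightarrow> int \<Rightarrow> complex" where
  "recip_qfact p k = (if k < 0 then 0 else inverse (\<Prod>i<nat k. 1 - p ^ Suc i))"

lemma one_minus_power_nonzero:
  fixes p :: complex
  assumes "norm p < 1"
  shows "1 - p ^ Suc i \<noteq> 0"
proof
  assume "1 - p ^ Suc i = 0"
  hence "norm (p ^ Suc i) = 1" by simp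
  moreover have "norm (p ^ Suc i) < 1"
    using assms by (simp only: norm_power power_less_one_iff norm_ge_zero) simp
  ultimately show False by simp
qed

lemma recip_qfact_rec:
  assumes "norm p < 1" "p \<noteq> 0"
  shows "recip_qfact p (k - 1) = (1 - p powi k) * recip_qfact p k"
proof (cases "k > 0")
  case True
  then obtain m where k: "k = int (Suc m)"
    by (metis Suc_pred' int_eq_iff zero_less_imp_eq_int)
  have "1 - p ^ Suc m \<noteq> 0" by (rule one_minus_power_nonzero[OF assms(1)])
  thus ?thesis by (simp add: k recip_qfact_def nat_add_distrib power_int_add assms power_int_def)
next
  case False
  thus ?thesis by (cases "k = 0") (auto simp: recip_qfact_def)
qed

lemma has_sum_int_shift:
  fixes f :: "int \<Rightarrow> 'a :: topological_comm_monoid_add"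
  shows "((\<lambda>j. f (j + k)) has_sum S) UNIV \<longleftrightarrow> (f has_sum S) UNIV"
  by (rule has_sum_reindex_bij_witness[of _ "\<lambda>j. j - k" "\<lambda>j. j + k"]) auto

text \<open>
  A form of the \<open>q\<close>-binomial theorem. Passing from \<open>n\<close> to \<open>n + 1\<close> multiplies the product by
  \<open>1 + s^(4n+2) + s^(2n+1) (x + 1/x)\<close>, and comparing coefficients leaves a three-term
  recurrence for the \<open>q\<close>-binomial coefficients.
\<close>
lemma finite_jacobi_triple_product:
  fixes s x :: complex
  assumes "norm s < 1" "s \<noteq> 0" "x \<noteq> 0"
  shows "((\<lambda>j. recip_qfact (s^2) (int n + j) * recip_qfact (s^2) (int n - j) *
             (s powi (j^2) * x powi j)) has_sum
           ((\<Prod>k<n. (1 + x * s ^ (2*k+1)) * (1 + s ^ (2*k+1) / x)) / (\<Prod>i<2*n. 1 - (s^2) ^ Suc i))) UNIV"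
proof (induction n)
  case 0
  show ?case
    by (rule has_sum_finite_neutralI[of "{0}"]) (auto simp: recip_qfact_def)
next
  case (Suc n)
  define p where "p = s^2"
  have p: "norm p < 1" "p \<noteq> 0"
    using assms by (auto simp: p_def norm_power power_less_one_iff)
  define r where "r = recip_qfact p"
  define t where "t = (\<lambda>j. r (int n + j) * r (int n - j) * (s powi (j^2) * x powi j))"
  define V where "V = (\<Prod>k<n. (1 + x * s ^ (2*k+1)) * (1 + s ^ (2*k+1) / x)) / (\<Prod>i<2*n. 1 - p ^ Suc i)"
  have IH: "(t has_sum V) UNIV"
    using Suc.IH by (simp add: t_def V_def r_def p_def)
  define d where "d = (1 - p ^ (2*n+1)) * (1 - p ^ (2*n+2))"
  have d0: "d \<noteq> 0"
    using one_minus_power_nonzero[OF p(1), of "2*n"] one_minus_power_nonzero[OF p(1), of "2*n+1"]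
    by (simp add: d_def)
  have shifts: "((\<lambda>j. t (j + -1)) has_sum V) UNIV" "((\<lambda>j. t (j + 1)) has_sum V) UNIV"
    using IH by (simp_all only: has_sum_int_shift)
  have "((\<lambda>j. ((1 + s ^ (4*n+2)) * t j + s ^ (2*n+1) * x * t (j + -1) + s ^ (2*n+1) / x * t (j + 1)) / d)
          has_sum (((1 + s ^ (4*n+2)) * V + s ^ (2*n+1) * x * V + s ^ (2*n+1) / x * V) / d)) UNIV"
    unfolding divide_inverse[of _ d]
    by (intro has_sum_cmult_left has_sum_add has_sum_cmult_right IH shifts)
  also have "((1 + s ^ (4*n+2)) * V + s ^ (2*n+1) * x * V + s ^ (2*n+1) / x * V) / d =
      (\<Prod>k<Suc n. (1 + x * s ^ (2*k+1)) * (1 + s ^ (2*k+1) / x)) / (\<Prod>i<2*Suc n. 1 - p ^ Suc i)"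
  proof -
    have e: "s ^ (4*n+2) = s ^ (2*n+1) * s ^ (2*n+1)"
      by (simp flip: power_add)
    have "(1 + s ^ (4*n+2)) * V + s ^ (2*n+1) * x * V + s ^ (2*n+1) / x * V =
            V * ((1 + x * s ^ (2*n+1)) * (1 + s ^ (2*n+1) / x))"
      unfolding e using assms(3) by (simp add: field_simps)
    moreover have "(\<Prod>i<2*Suc n. 1 - p ^ Suc i) = (\<Prod>i<2*n. 1 - p ^ Suc i) * d"
      by (simp add: d_def)
    ultimately show ?thesis by (simp only: V_def prod.lessThan_Suc times_divide_eq_left divide_divide_eq_left)
  qed
  also have "(\<lambda>j. ((1 + s ^ (4*n+2)) * t j + s ^ (2*n+1) * x * t (j + -1) + s ^ (2*n+1) / x * t (j + 1)) / d) =
             (\<lambda>j. r (int (Suc n) + j) * r (int (Suc n) - j) * (s powi (j^2) * x powi j))"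
  proof
    fix j :: int
    \<comment> \<open>All four terms are multiples of \<open>r a * r b\<close>, with coefficients rational in \<open>A\<close> and \<open>B\<close>.\<close>
    define a b where "a = int (Suc n) + j" and "b = int (Suc n) - j"
    define A B where "A = p powi a" and "B = p powi b"
    define e where "e = s powi (j^2) * x powi j"
    have AB: "A * B = p ^ (2*n+2)"
      unfolding A_def B_def power_int_add[OF disjI1[OF p(2)], symmetric]
      by (simp add: a_def b_def flip: power_int_of_nat)
    have d_eq: "d = (1 - A * B / p) * (1 - A * B)"
      unfolding AB d_def using p(2) by simp
    have s4: "s ^ (4*n+2) = A * B / p"
    proof -
      have "A * B / p = p ^ (2*n+1)" unfolding AB using p(2) by simp
      also have "\<dots> = s ^ (2 * (2*n+1))" unfolding p_def power_mult ..
      finally show ?thesis by simp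
    qed
    have r1: "r (k - 1) = (1 - p powi k) * r k" for k
      unfolding r_def by (rule recip_qfact_rec[OF p])
    have r2: "r (k - 2) = (1 - p powi k / p) * (1 - p powi k) * r k" for k
      using r1[of k] r1[of "k - 1"] p(2) by (simp add: power_int_diff)
    have t0: "t j = (1 - A) * (1 - B) * (r a * r b) * e"
      using r1[of a] r1[of b] unfolding t_def e_def A_def B_def by (simp add: a_def b_def)
    have t1: "s ^ (2*n+1) * x * t (j + -1) = B * (1 - A / p) * (1 - A) * (r a * r b) * e"
    proof -
      have "int (2*n+1) + (j - 1)^2 = 2 * b + j^2"
        by (simp add: b_def power2_eq_square algebra_simps)
      hence "s ^ (2*n+1) * s powi ((j - 1)^2) = s powi (2 * b + j^2)"
        by (simp only: power_int_of_nat[symmetric] power_int_add[OF disjI1[OF assms(2)], symmetric])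
      also have "\<dots> = B * s powi (j^2)"
        unfolding power_int_add[OF disjI1[OF assms(2)]] B_def p_def power_int_mult by simp
      finally have 1: "s ^ (2*n+1) * s powi ((j - 1)^2) = B * s powi (j^2)" .
      have 2: "x * x powi (j - 1) = x powi j"
        using assms(3) by (simp add: power_int_diff)
      have 3: "t (j + -1) = r (a - 2) * r b * (s powi ((j - 1)^2) * x powi (j - 1))"
        by (simp add: t_def a_def b_def algebra_simps)
      have "s ^ (2*n+1) * x * t (j + -1) = r (a - 2) * r b * (s ^ (2*n+1) * s powi ((j - 1)^2)) * (x * x powi (j - 1))"
        unfolding 3 by simp
      also have "\<dots> = r (a - 2) * r b * B * e"
        unfolding 1 2 e_def by simp
      finally show ?thesis by (simp add: r2 A_def mult_ac)
    qed
    have t2: "s ^ (2*n+1) / x * t (j + 1) = A * (1 - B / p) * (1 - B) * (r a * r b) * e"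
    proof -
      have "int (2*n+1) + (j + 1)^2 = 2 * a + j^2"
        by (simp add: a_def power2_eq_square algebra_simps)
      hence "s ^ (2*n+1) * s powi ((j + 1)^2) = s powi (2 * a + j^2)"
        by (simp only: power_int_of_nat[symmetric] power_int_add[OF disjI1[OF assms(2)], symmetric])
      also have "\<dots> = A * s powi (j^2)"
        unfolding power_int_add[OF disjI1[OF assms(2)]] A_def p_def power_int_mult by simp
      finally have 1: "s ^ (2*n+1) * s powi ((j + 1)^2) = A * s powi (j^2)" .
      have 2: "x powi (j + 1) / x = x powi j"
        using assms(3) by (simp add: power_int_add)
      have 3: "t (j + 1) = r a * r (b - 2) * (s powi ((j + 1)^2) * x powi (j + 1))"
        by (simp add: t_def a_def b_def algebra_simps)
      have "s ^ (2*n+1) / x * t (j + 1) = r a * r (b - 2) * (s ^ (2*n+1) * s powi ((j + 1)^2)) * (x powi (j + 1) / x)"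
        unfolding 3 by simp
      also have "\<dots> = r a * r (b - 2) * A * e"
        unfolding 1 2 e_def by simp
      finally show ?thesis by (simp add: r2 B_def mult_ac)
    qed
    have alg: "(1 + A * B / p) * ((1 - A) * (1 - B)) + B * (1 - A / p) * (1 - A) + A * (1 - B / p) * (1 - B) =
          (1 - A * B / p) * (1 - A * B)"
      using p(2) by (simp add: field_simps)
    have "(1 + s ^ (4*n+2)) * t j + s ^ (2*n+1) * x * t (j + -1) + s ^ (2*n+1) / x * t (j + 1) =
          ((1 + A * B / p) * ((1 - A) * (1 - B)) + B * (1 - A / p) * (1 - A) + A * (1 - B / p) * (1 - B)) * (r a * r b * e)"
      unfolding t0 t1 t2 s4 by (simp only: distrib_right mult.assoc)
    also have "\<dots> = d * (r a * r b * e)"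
      unfolding alg d_eq ..
    finally show "((1 + s ^ (4*n+2)) * t j + s ^ (2*n+1) * x * t (j + -1) + s ^ (2*n+1) / x * t (j + 1)) / d =
        r (int (Suc n) + j) * r (int (Suc n) - j) * (s powi (j^2) * x powi j)"
      using d0 by (simp add: a_def b_def e_def)
  qed
  finally show ?case by (simp add: r_def p_def)
qed

text \<open>
  Dominated convergence for sums over the integers, transferred from Tannery's theorem along an
  enumeration of the integers.
\<close>
lemma tannery_int:
  fixes f :: "int \<Rightarrow> nat \<Rightarrow> complex"
  assumes lim: "\<And>j. (\<lambda>n. f j n) \<longlonglongrightarrow> g j"
    and bound: "\<And>j n. norm (f j n) \<le> M j"
    and M: "M summable_on UNIV"
    and sums: "\<And>n. ((\<lambda>j. f j n) has_sum S n) UNIV" "S \<longlonglongrightarrow> L"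
  shows "(g has_sum L) UNIV"
proof -
  have bij: "bij_betw int_decode UNIV UNIV" by (rule bij_int_decode)
  have "(\<lambda>k. M (int_decode k)) summable_on UNIV"
    using M summable_on_reindex_bij_betw[OF bij, of M] by simp
  hence sumM: "summable (\<lambda>k. M (int_decode k))"
    by (rule summable_on_imp_summable)
  have T: "eventually (\<lambda>n. summable (\<lambda>k. norm (f (int_decode k) n))) sequentially \<and>
           summable (\<lambda>k. norm (g (int_decode k))) \<and>
           (\<lambda>n. suminf (\<lambda>k. f (int_decode k) n)) \<longlonglongrightarrow> suminf (\<lambda>k. g (int_decode k))"
    by (rule tannerys_theorem[OF _ _ sumM]) (auto intro: lim bound always_eventually)
  have "suminf (\<lambda>k. f (int_decode k) n) = S n" for n
  proof -
    have "((\<lambda>k. f (int_decode k) n) has_sum S n) UNIV"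
      using sums(1)[of n] has_sum_reindex_bij_betw[OF bij, of "\<lambda>j. f j n"] by simp
    from sums_unique[OF has_sum_imp_sums[OF this]] show ?thesis by simp
  qed
  with T have "S \<longlonglongrightarrow> suminf (\<lambda>k. g (int_decode k))" by simp
  hence L: "suminf (\<lambda>k. g (int_decode k)) = L" by (rule LIMSEQ_unique[OF _ sums(2)])
  have "summable (\<lambda>k. g (int_decode k))" using T by (simp add: summable_norm_cancel)
  hence "(\<lambda>k. g (int_decode k)) sums L" unfolding L[symmetric] by (rule summable_sums)
  hence "((\<lambda>k. g (int_decode k)) has_sum L) UNIV"
    using T by (intro norm_summable_imp_has_sum) auto
  thus ?thesis using has_sum_reindex_bij_betw[OF bij, of g] by simp
qed

lemma summable_power_square:
  fixes r X :: real
  assumes "0 < r" "r < 1" "0 < X"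
  shows "summable (\<lambda>n. r ^ (n^2) * X ^ n)"
proof (rule summable_comparison_test_ev)
  have "(\<lambda>n. r ^ n * X) \<longlonglongrightarrow> 0 * X"
    using assms by (intro tendsto_intros LIMSEQ_realpow_zero) auto
  hence "eventually (\<lambda>n. r ^ n * X < 1/2) sequentially"
    by (rule order_tendstoD) auto
  thus "eventually (\<lambda>n. norm (r ^ (n^2) * X ^ n) \<le> (1/2) ^ n) sequentially"
  proof eventually_elim
    case (elim n)
    have "r ^ (n^2) * X ^ n = (r ^ n * X) ^ n"
      by (simp add: power_mult_distrib power2_eq_square flip: power_mult)
    also have "\<dots> \<le> (1/2) ^ n"
      using elim assms by (intro power_mono) auto
    finally show ?case using assms by simp
  qed
qed (auto intro: summable_geometric)

lemma summable_on_power_square_int: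
  fixes r X :: real
  assumes "0 < r" "r < 1" "0 < X"
  shows "(\<lambda>j::int. r powi (j^2) * X powi j) summable_on UNIV"
proof -
  have nat: "(\<lambda>n. r ^ (n^2) * X ^ n) summable_on UNIV" if "0 < X" for X
    using assms that by (subst summable_on_UNIV_nonneg_real_iff) (auto intro!: summable_power_square)
  have sq: "r powi (int n)^2 = r ^ n^2" for n
    by (simp flip: power_int_of_nat)
  have "(\<lambda>j::int. r powi (j^2) * X powi j) summable_on range int"
    using nat[OF assms(3)] by (subst summable_on_reindex) (auto simp: o_def sq)
  moreover have "(\<lambda>j::int. r powi (j^2) * X powi j) summable_on range (\<lambda>n. - int n)"
    using nat[of "inverse X"] assms
    by (subst summable_on_reindex) (auto simp: o_def sq inj_on_def power_int_minus power_inverse)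
  ultimately have "(\<lambda>j::int. r powi (j^2) * X powi j) summable_on (range int \<union> range (\<lambda>n. - int n))"
    using summable_on_union by blast
  also have "range int \<union> range (\<lambda>n. - int n) = UNIV"
  proof -
    have "\<exists>n. j = int n \<or> j = - int n" for j by (metis int_cases2)
    thus ?thesis by blast
  qed
  finally show ?thesis .
qed

lemma recip_qfact_LIMSEQ:
  assumes "norm p < 1" "p \<noteq> 0"
  shows "(\<lambda>n. recip_qfact p (int n + j)) \<longlonglongrightarrow> inverse (qpoch p p)"
proof -
  have E: "qpoch p p \<noteq> 0" using assms by (intro qpoch_nonzero) auto
  have "(\<lambda>n. inverse (\<Prod>i<n. 1 - p ^ Suc i)) \<longlonglongrightarrow> inverse (qpoch p p)"
    using qpoch_LIMSEQ[OF assms(1), of p] E by (intro tendsto_intros) auto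
  moreover have "filterlim (\<lambda>n. nat (int n + j)) at_top sequentially"
    unfolding filterlim_at_top
  proof
    fix Z
    show "\<forall>\<^sub>F n in sequentially. Z \<le> nat (int n + j)"
      using eventually_ge_at_top[of "Z + nat \<bar>j\<bar>"]
    proof eventually_elim
      case (elim n)
      hence "int Z + \<bar>j\<bar> \<le> int n" by simp
      hence "int Z \<le> int n + j" by linarith
      thus ?case by linarith
    qed
  qed
  ultimately have "(\<lambda>n. inverse (\<Prod>i<nat (int n + j). 1 - p ^ Suc i)) \<longlonglongrightarrow> inverse (qpoch p p)"
    by (rule filterlim_compose)
  moreover have "eventually (\<lambda>n. inverse (\<Prod>i<nat (int n + j). 1 - p ^ Suc i) = recip_qfact p (int n + j)) sequentially"
    using eventually_ge_at_top[of "nat \<bar>j\<bar>"]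
  proof eventually_elim
    case (elim n)
    hence "\<not> int n + j < 0" by linarith
    thus ?case unfolding recip_qfact_def by (simp only: if_False)
  qed
  ultimately show ?thesis by (rule Lim_transform_eventually)
qed

lemma recip_qfact_bounded:
  assumes "norm p < 1" "p \<noteq> 0"
  obtains C where "C > 0" "\<And>k. norm (recip_qfact p k) \<le> C"
proof -
  have "Bseq (\<lambda>n. recip_qfact p (int n + 0))"
    using recip_qfact_LIMSEQ[OF assms] by (intro convergent_imp_Bseq convergentI)
  then obtain C where C: "C > 0" "\<And>n. norm (recip_qfact p (int n)) \<le> C"
    by (auto elim: BseqE)
  have "norm (recip_qfact p k) \<le> C" for k
    using C by (cases k) (auto simp: recip_qfact_def)
  with C(1) that show ?thesis by blast
qed

text \<open>
  The limit of the finite identity: the \<open>q\<close>-binomial coefficients are bounded and converge to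
  \<open>1 / E(s\<^sup>2)\<close>, and the remaining Gaussian factor gives a summable majorant.
\<close>
theorem jacobi_triple_product:
  fixes s x :: complex
  assumes "norm s < 1" "s \<noteq> 0" "x \<noteq> 0"
  shows "((\<lambda>j. s powi (j^2) * x powi j) has_sum
           (qpoch (s^2) (s^2) * qpoch (- x * s) (s^2) * qpoch (- s / x) (s^2))) UNIV"
proof -
  define p where "p = s^2"
  have p: "norm p < 1" "p \<noteq> 0"
    using assms by (auto simp: p_def norm_power power_less_one_iff)
  have E: "qpoch p p \<noteq> 0" using p by (intro qpoch_nonzero) auto
  obtain C where C: "C > 0" "\<And>k. norm (recip_qfact p k) \<le> C"
    using recip_qfact_bounded[OF p] by blast
  define N where "N = (\<lambda>n. (\<Prod>k<n. (1 + x * s ^ (2*k+1)) * (1 + s ^ (2*k+1) / x)))"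
  have N: "N n = (\<Prod>k<n. 1 - (- x * s) * p ^ k) * (\<Prod>k<n. 1 - (- s / x) * p ^ k)" for n
    by (simp add: N_def p_def prod.distrib mult_ac flip: power_mult)
  have "((\<lambda>j. inverse (qpoch p p) * inverse (qpoch p p) * (s powi (j^2) * x powi j)) has_sum
          (qpoch (- x * s) p * qpoch (- s / x) p / qpoch p p)) UNIV"
  proof (rule tannery_int)
    fix j
    show "(\<lambda>n. recip_qfact p (int n + j) * recip_qfact p (int n - j) * (s powi (j^2) * x powi j))
            \<longlonglongrightarrow> inverse (qpoch p p) * inverse (qpoch p p) * (s powi (j^2) * x powi j)"
      using recip_qfact_LIMSEQ[OF p, of j] recip_qfact_LIMSEQ[OF p, of "-j"]
      by (intro tendsto_intros) auto
  next
    fix j n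
    show "norm (recip_qfact p (int n + j) * recip_qfact p (int n - j) * (s powi (j^2) * x powi j))
            \<le> C * C * (norm s powi (j^2) * norm x powi j)"
      unfolding norm_mult norm_power_int
      using C by (intro mult_mono) (auto intro!: mult_nonneg_nonneg less_imp_le)
  next
    show "(\<lambda>j. C * C * (norm s powi (j^2) * norm x powi j)) summable_on UNIV"
      using assms by (intro summable_on_cmult_right summable_on_power_square_int) auto
  next
    fix n
    show "((\<lambda>j. recip_qfact p (int n + j) * recip_qfact p (int n - j) * (s powi (j^2) * x powi j)) has_sum
            N n / (\<Prod>i<2*n. 1 - p * p ^ i)) UNIV"
      using finite_jacobi_triple_product[OF assms, of n] by (simp add: p_def N_def)
  next
    have "(\<lambda>n. \<Prod>i<2*n. 1 - p * p ^ i) \<longlonglongrightarrow> qpoch p p"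
      by (rule filterlim_compose[OF qpoch_LIMSEQ[OF p(1)]])
         (auto intro!: filterlim_subseq simp: strict_mono_def)
    thus "(\<lambda>n. N n / (\<Prod>i<2*n. 1 - p * p ^ i)) \<longlonglongrightarrow> qpoch (- x * s) p * qpoch (- s / x) p / qpoch p p"
      unfolding N by (intro tendsto_intros qpoch_LIMSEQ p E)
  qed
  from has_sum_cmult_right[OF this, of "qpoch p p * qpoch p p"]
  have "((\<lambda>j. s powi (j^2) * x powi j) has_sum
          (qpoch p p * qpoch p p * (qpoch (- x * s) p * qpoch (- s / x) p / qpoch p p))) UNIV"
    by (rule back_subst[of "\<lambda>f. (f has_sum _) _"]) (use E in \<open>simp add: fun_eq_iff field_simps\<close>)
  also have "qpoch p p * qpoch p p * (qpoch (- x * s) p * qpoch (- s / x) p / qpoch p p) =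
             qpoch p p * qpoch (- x * s) p * qpoch (- s / x) p"
    using E by simp
  finally show ?thesis by (simp only: p_def)
qed

section \<open>Trisection of theta series\<close>

lemma has_sum_trisect_int:
  fixes f :: "int \<Rightarrow> 'a :: topological_comm_monoid_add"
  assumes "((\<lambda>k. f (3 * k)) has_sum A) UNIV"
    and "((\<lambda>k. f (3 * k + 1)) has_sum B) UNIV"
    and "((\<lambda>k. f (3 * k - 1)) has_sum C) UNIV"
  shows "(f has_sum (A + B + C)) UNIV"
proof -
  have 1: "(f has_sum A) (range (\<lambda>k. 3 * k))" "(f has_sum B) (range (\<lambda>k. 3 * k + 1))"
          "(f has_sum C) (range (\<lambda>k. 3 * k - 1))"
    using assms by (subst has_sum_reindex; force simp: inj_on_def o_def)+
  have ne: "3 * k \<noteq> 3 * l + 1" "3 * k \<noteq> 3 * l - 1" "3 * k + 1 \<noteq> 3 * l - 1" for k l :: int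
    by presburger+
  have "(f has_sum (A + B + C)) ((range (\<lambda>k. 3 * k) \<union> range (\<lambda>k. 3 * k + 1)) \<union> range (\<lambda>k. 3 * k - 1))"
    by (intro has_sum_Un_disjoint 1; use ne in blast)
  also have "(range (\<lambda>k. 3 * k) \<union> range (\<lambda>k. 3 * k + 1)) \<union> range (\<lambda>k::int. 3 * k - 1) = UNIV"
  proof -
    have "\<exists>k. j = 3 * k \<or> j = 3 * k + 1 \<or> j = 3 * k - 1" for j :: int by presburger
    thus ?thesis by blast
  qed
  finally show ?thesis .
qed

definition euler_prod :: "complex \<Rightarrow> complex" where
  "euler_prod p = qpoch p p"

lemma norm_power_less_one:
  fixes q :: complex
  assumes "norm q < 1" "n > 0"
  shows "norm (q ^ n) < 1"
  using assms by (simp add: norm_power power_less_one_iff)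

lemma euler_prod_nonzero: "norm q < 1 \<Longrightarrow> euler_prod q \<noteq> 0"
  unfolding euler_prod_def by (intro qpoch_nonzero) auto

lemma qpoch_odd:
  assumes "norm q < 1"
  shows "qpoch q (q^2) = euler_prod q / euler_prod (q^2)"
  using qpoch_split2[OF assms, of q] euler_prod_nonzero[OF norm_power_less_one[OF assms, of 2]]
  by (simp add: euler_prod_def field_simps power2_eq_square)

lemma qpoch_minus_self:
  assumes "norm q < 1"
  shows "qpoch (- q) q = euler_prod (q^2) / euler_prod q"
  using qpoch_times_minus[OF assms, of q] euler_prod_nonzero[OF assms]
  by (simp add: euler_prod_def field_simps)

lemma minus_power_int: "(- y) powi k = (-1) powi k * (y :: complex) powi k"
  using power_int_mult_distrib[of "-1" y k] by simp

lemma minus_one_powi_3: "(-1 :: complex) powi (3 * k) = (-1) powi k"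
  by (simp add: power_int_mult)

text \<open>
  The series is Ramanujan's \<open>\<phi>(-q)\<close>.
\<close>
lemma theta3_product:
  assumes "norm q < 1" "q \<noteq> 0"
  shows "((\<lambda>j. q powi (j^2) * (-1) powi j) has_sum (euler_prod q ^ 2 / euler_prod (q^2))) UNIV"
  using jacobi_triple_product[OF assms, of "-1"] qpoch_odd[OF assms(1)]
    euler_prod_nonzero[OF norm_power_less_one[OF assms(1), of 2]]
  by (simp add: euler_prod_def power2_eq_square)

text \<open>
  In the notation of the introduction this is \<open>\<phi>(-q) = \<phi>(-q\<^sup>9) (1 - 2u)\<close>. The multiples of 3 contribute
  \<open>\<phi>(-q\<^sup>9)\<close>. The other two classes are exchanged by \<open>j \<mapsto> -j\<close> and therefore contribute equally.
\<close>
lemma theta3_trisection: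
  assumes q: "norm q < 1" "q \<noteq> 0"
  shows "euler_prod q ^ 2 / euler_prod (q^2) =
           euler_prod (q^9) ^ 2 / euler_prod (q^18) -
           2 * q * euler_prod (q^18) ^ 2 * euler_prod (q^3) / (euler_prod (q^6) * euler_prod (q^9))"
proof -
  define f where "f = (\<lambda>j::int. q powi (j^2) * (-1) powi j)"
  define S where "S = euler_prod (q^18) * qpoch (q^15) (q^18) * qpoch (q^3) (q^18)"
  have q': "norm (q ^ n) < 1" if "n > 0" for n
    using norm_power_less_one[OF q(1) that] .
  have nz: "euler_prod (q ^ n) \<noteq> 0" if "n > 0" for n
    using euler_prod_nonzero[OF q'[OF that]] .
  have "(f has_sum (euler_prod (q^9) ^ 2 / euler_prod (q^18) + - q * S + - q * S)) UNIV"
  proof (rule has_sum_trisect_int)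
    have "(\<lambda>k. f (3 * k)) = (\<lambda>k. (q^9) powi (k^2) * (-1) powi k)"
      unfolding f_def minus_one_powi_3
      by (simp add: power_mult_distrib power_int_mult)
    thus "((\<lambda>k. f (3 * k)) has_sum (euler_prod (q^9) ^ 2 / euler_prod (q^18))) UNIV"
      using theta3_product[of "q^9"] q q'[of 9] by (simp flip: power_mult)
  next
    have "f (3 * k + 1) = - q * ((q^9) powi (k^2) * (- (q^6)) powi k)" for k
    proof -
      have "q powi ((3 * k + 1)^2) = q powi (9 * k^2 + 6 * k + 1)"
        by (rule arg_cong[of _ _ "\<lambda>e. q powi e"]) (simp add: power2_eq_square algebra_simps)
      also have "\<dots> = q * ((q^9) powi (k^2) * (q^6) powi k)"
        using q(2) by (simp add: power_int_add power_int_mult)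
      finally show ?thesis
        unfolding f_def minus_power_int[of "q^6"]
        by (simp add: power_int_add minus_one_powi_3)
    qed
    moreover have "q^6 * q^9 = q^15" "q^9 / q^6 = q^3"
      using q(2) by (simp_all add: field_simps flip: power_add)
    ultimately show "((\<lambda>k. f (3 * k + 1)) has_sum (- q * S)) UNIV"
      using has_sum_cmult_right[OF jacobi_triple_product[of "q^9" "- (q^6)"], of "- q"] q q'[of 9]
      by (simp add: S_def euler_prod_def mult_ac flip: power_mult)
  next
    have "f (3 * k - 1) = - q * ((q^9) powi (k^2) * (- inverse (q^6)) powi k)" for k
    proof -
      have "q powi ((3 * k - 1)^2) = q powi (9 * k^2 - 6 * k + 1)"
        by (rule arg_cong[of _ _ "\<lambda>e. q powi e"]) (simp add: power2_eq_square algebra_simps)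
      also have "\<dots> = q * ((q^9) powi (k^2) * inverse (q^6) powi k)"
        using q(2) by (simp add: power_int_add power_int_diff power_int_mult power_int_inverse divide_inverse)
      finally show ?thesis
        unfolding f_def minus_power_int[of "inverse (q^6)"]
        by (simp add: power_int_diff minus_one_powi_3)
    qed
    moreover have "inverse (q^6) * q^9 = q^3" "q^9 / inverse (q^6) = q^15"
      using q(2) by (simp_all add: field_simps flip: power_add)
    ultimately show "((\<lambda>k. f (3 * k - 1)) has_sum (- q * S)) UNIV"
      using has_sum_cmult_right[OF jacobi_triple_product[of "q^9" "- inverse (q^6)"], of "- q"] q q'[of 9]
      by (simp add: S_def euler_prod_def mult_ac flip: power_mult)
  qed
  hence "euler_prod q ^ 2 / euler_prod (q^2) = euler_prod (q^9) ^ 2 / euler_prod (q^18) - 2 * q * S"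
    using has_sum_unique[OF theta3_product[OF q]] by (force simp: f_def)
  also have "S = euler_prod (q^18) ^ 2 * euler_prod (q^3) / (euler_prod (q^6) * euler_prod (q^9))"
  proof -
    have "qpoch (q^3) (q^6) = qpoch (q^3) (q^18) * qpoch (q^9) (q^18) * qpoch (q^15) (q^18)"
      using qpoch_split3[OF q'[of 6], of "q^3"] by (simp flip: power_mult power_add)
    moreover have "qpoch (q^3) (q^6) = euler_prod (q^3) / euler_prod (q^6)"
      using qpoch_odd[OF q'[of 3]] by (simp flip: power_mult)
    moreover have "qpoch (q^9) (q^18) = euler_prod (q^9) / euler_prod (q^18)"
      using qpoch_odd[OF q'[of 9]] by (simp flip: power_mult)
    ultimately show ?thesis
      using nz[of 3] nz[of 6] nz[of 9] nz[of 18] by (simp add: S_def field_simps power2_eq_square)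
  qed
  finally show ?thesis by simp
qed

text \<open>
  With \<open>q = s\<^sup>2\<close> the exponents are twice the triangular numbers, each of which occurs for two integers \<open>j\<close>.
  The sum is \<open>2 \<psi>(q)\<close>; the square root \<open>s\<close> keeps all exponents of the form required by the triple
  product.
\<close>
lemma triangular_theta_product:
  assumes "norm s < 1" "s \<noteq> 0"
  shows "((\<lambda>j. s powi (j^2) * s powi j) has_sum (2 * euler_prod (s^4) ^ 2 / euler_prod (s^2))) UNIV"
proof -
  have s2: "norm (s^2) < 1" by (rule norm_power_less_one) (use assms in auto)
  have "qpoch (- 1) (s^2) = 2 * qpoch (- (s^2)) (s^2)"
    using qpoch_unfold[OF s2, of "-1"] by simp
  moreover have "qpoch (- (s^2)) (s^2) = euler_prod (s^4) / euler_prod (s^2)"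
    using qpoch_minus_self[OF s2] by (simp flip: power_mult)
  ultimately show ?thesis
    using jacobi_triple_product[OF assms assms(2)] assms euler_prod_nonzero[OF s2]
    by (simp add: power2_eq_square[of s, symmetric] flip: euler_prod_def)
       (simp add: power2_eq_square mult_ac)
qed

text \<open>
  In the notation of the introduction this is \<open>\<psi>(q) = q \<psi>(q\<^sup>9) (1 + 1/u)\<close>. Here the class of 1 modulo 3
  reproduces \<open>\<psi>\<close>, and the other two are exchanged by \<open>j \<mapsto> -1 - j\<close>.
\<close>
lemma triangular_theta_trisection:
  assumes q: "norm q < 1" "q \<noteq> 0"
  shows "euler_prod (q^2) ^ 2 / euler_prod q =
           euler_prod (q^9) ^ 2 * euler_prod (q^6) / (euler_prod (q^3) * euler_prod (q^18)) +
           q * euler_prod (q^18) ^ 2 / euler_prod (q^9)"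
proof -
  define s where "s = csqrt q"
  have sq: "s ^ 2 = q" by (simp add: s_def)
  have s: "norm s < 1" "s \<noteq> 0"
    using q by (auto simp: s_def norm_csqrt)
  have sn: "s ^ (2 * n) = q ^ n" for n by (simp add: power_mult sq)
  have sn': "s ^ 18 = q ^ 9" "s ^ 12 = q ^ 6" "s ^ 6 = q ^ 3" "s ^ 36 = q ^ 18" "s ^ 4 = q ^ 2"
    using sn[of 9] sn[of 6] sn[of 3] sn[of 18] sn[of 2] by simp_all
  define f where "f = (\<lambda>j::int. s powi (j^2) * s powi j)"
  define S where "S = euler_prod (q^9) * qpoch (- (q^6)) (q^9) * qpoch (- (q^3)) (q^9)"
  have q': "norm (q ^ n) < 1" if "n > 0" for n
    using norm_power_less_one[OF q(1) that] .
  have s9: "norm (s ^ 9) < 1" by (rule norm_power_less_one) (use s in auto)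
  have nz: "euler_prod (q ^ n) \<noteq> 0" if "n > 0" for n
    using euler_prod_nonzero[OF q'[OF that]] .
  have "(f has_sum (S + q * (2 * euler_prod (q^18) ^ 2 / euler_prod (q^9)) + S)) UNIV"
  proof (rule has_sum_trisect_int)
    have "(\<lambda>k. f (3 * k)) = (\<lambda>k. (s^9) powi (k^2) * (s^3) powi k)"
      unfolding f_def by (simp add: power_mult_distrib power_int_mult)
    moreover have "s^3 * s^9 = s^12" "s^9 / s^3 = s^6"
      using s(2) by (simp_all add: field_simps flip: power_add)
    ultimately show "((\<lambda>k. f (3 * k)) has_sum S) UNIV"
      using jacobi_triple_product[OF s9, of "s^3"] s
      by (simp add: S_def euler_prod_def sn' mult_ac flip: power_mult)
  next
    have "f (3 * k + 1) = q * ((s^9) powi (k^2) * (s^9) powi k)" for k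
    proof -
      have "f (3 * k + 1) = s powi ((3 * k + 1)^2 + (3 * k + 1))"
        using s(2) by (simp add: f_def power_int_add)
      also have "(3 * k + 1)^2 + (3 * k + 1) = 9 * k^2 + 9 * k + 2"
        by (simp add: power2_eq_square algebra_simps)
      also have "s powi \<dots> = q * ((s^9) powi (k^2) * (s^9) powi k)"
        using s(2) by (simp add: power_int_add power_int_mult sq)
      finally show ?thesis .
    qed
    thus "((\<lambda>k. f (3 * k + 1)) has_sum q * (2 * euler_prod (q^18) ^ 2 / euler_prod (q^9))) UNIV"
      using has_sum_cmult_right[OF triangular_theta_product[OF s9], of q] s
      by (simp add: sn' flip: power_mult)
  next
    have "f (3 * k - 1) = (s^9) powi (k^2) * (inverse (s^3)) powi k" for k
    proof -
      have "f (3 * k - 1) = s powi ((3 * k - 1)^2 + (3 * k - 1))"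
        using s(2) by (simp only: f_def power_int_add[OF disjI1[OF s(2)]])
      also have "(3 * k - 1)^2 + (3 * k - 1) = 9 * k^2 - 3 * k"
        by (simp add: power2_eq_square algebra_simps)
      also have "s powi \<dots> = (s^9) powi (k^2) * (inverse (s^3)) powi k"
        using s(2) by (simp add: power_int_diff power_int_mult power_int_inverse divide_inverse)
      finally show ?thesis .
    qed
    moreover have "inverse (s^3) * s^9 = s^6" "s^9 / inverse (s^3) = s^12"
      using s(2) by (simp_all add: field_simps flip: power_add)
    ultimately show "((\<lambda>k. f (3 * k - 1)) has_sum S) UNIV"
      using jacobi_triple_product[OF s9, of "inverse (s^3)"] s
      by (simp add: S_def euler_prod_def sn' mult_ac flip: power_mult)
  qed
  moreover have "(f has_sum (2 * euler_prod (q^2) ^ 2 / euler_prod q)) UNIV"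
    using triangular_theta_product[OF s] by (simp add: f_def sn' sq)
  ultimately have "2 * euler_prod (q^2) ^ 2 / euler_prod q = 2 * S + 2 * (q * (euler_prod (q^18) ^ 2 / euler_prod (q^9)))"
    using has_sum_unique by force
  hence "2 * (euler_prod (q^2) ^ 2 / euler_prod q) = 2 * (S + q * (euler_prod (q^18) ^ 2 / euler_prod (q^9)))"
    by (simp only: distrib_left times_divide_eq_right)
  hence "euler_prod (q^2) ^ 2 / euler_prod q = S + q * (euler_prod (q^18) ^ 2 / euler_prod (q^9))"
    by (rule mult_left_cancel[THEN iffD1, rotated]) simp
  also have "S = euler_prod (q^9) ^ 2 * euler_prod (q^6) / (euler_prod (q^3) * euler_prod (q^18))"
  proof -
    have "qpoch (- (q^3)) (q^3) = qpoch (- (q^3)) (q^9) * qpoch (- (q^6)) (q^9) * qpoch (- (q^9)) (q^9)"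
      using qpoch_split3[OF q'[of 3], of "- (q^3)"] by (simp flip: power_mult power_add)
    moreover have "qpoch (- (q^3)) (q^3) = euler_prod (q^6) / euler_prod (q^3)"
      using qpoch_minus_self[OF q'[of 3]] by (simp flip: power_mult)
    moreover have "qpoch (- (q^9)) (q^9) = euler_prod (q^18) / euler_prod (q^9)"
      using qpoch_minus_self[OF q'[of 9]] by (simp flip: power_mult)
    ultimately show ?thesis
      using nz[of 3] nz[of 6] nz[of 9] nz[of 18] by (simp add: S_def field_simps power2_eq_square)
  qed
  finally show ?thesis by simp
qed

text \<open>
  In \<open>E(q) E(\<omega>q) E(\<omega>\<^sup>2q)\<close>, the factors with index prime to 3 combine to \<open>1 - q^(3n)\<close> and those with index
  divisible by 3 occur three times.
\<close>
lemma euler_prod_cube_roots: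
  assumes q: "norm q < 1" and w: "w^2 + w + 1 = 0"
  shows "euler_prod q * euler_prod (w * q) * euler_prod (w^2 * q) * euler_prod (q^9) = euler_prod (q^3) ^ 4"
proof -
  have w3: "w ^ 3 = 1" using w by algebra
  hence nw: "norm w = 1" by (metis norm_one norm_power power_eq_1_iff norm_ge_zero zero_neq_numeral)
  have q3: "norm (q^3) < 1" by (rule norm_power_less_one) (use q in auto)
  have split: "euler_prod (v * q) = qpoch (v * q) (q^3) * qpoch (v^2 * q^2) (q^3) * euler_prod (q^3)"
    if "v ^ 3 = 1" "norm v = 1" for v
    using qpoch_split3[of "v * q" "v * q"] q that
    by (simp add: euler_prod_def norm_mult power_mult_distrib flip: power2_eq_square)
       (simp add: power3_eq_cube power2_eq_square power_mult_distrib mult_ac)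
  have w4: "(w^2)^2 = w" "(w^2)^3 = 1" "w^6 = 1" using w3 by algebra+
  have "euler_prod q * euler_prod (w * q) * euler_prod (w^2 * q) =
        (qpoch q (q^3) * qpoch (w * q) (q^3) * qpoch (w^2 * q) (q^3)) *
        (qpoch (q^2) (q^3) * qpoch (w * q^2) (q^3) * qpoch (w^2 * q^2) (q^3)) * euler_prod (q^3) ^ 3"
    using split[of 1] split[of w] split[of "w^2"] w3 w4 nw
    by (simp add: norm_power power3_eq_cube)
  also have "\<dots> = qpoch (q^3) (q^9) * qpoch (q^6) (q^9) * euler_prod (q^3) ^ 3"
    using qpoch_times_cube_roots[OF q3 w, of q] qpoch_times_cube_roots[OF q3 w, of "q^2"]
    by (simp flip: power_mult)
  finally show ?thesis
    using qpoch_split3[OF q3, of "q^3"]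
    by (simp add: euler_prod_def eval_nat_numeral mult_ac flip: power_mult power_add)
qed


section \<open>Eta quotients of level 18\<close>

text \<open>
  The function \<open>u\<close> of the theorem in terms of the nome: the fractional powers of \<open>q\<close> in the four eta functions
  combine to the factor \<open>q\<close>.
\<close>
definition level18_hauptmodul :: "complex \<Rightarrow> complex" where
  "level18_hauptmodul q = q * euler_prod (q^3) * euler_prod (q^18) ^ 3 / (euler_prod (q^6) * euler_prod (q^9) ^ 3)"

lemma hauptmodul_nonzero:
  assumes "norm q < 1" "q \<noteq> 0"
  shows "level18_hauptmodul q \<noteq> 0"
  using assms euler_prod_nonzero[OF norm_power_less_one[OF assms(1)]]
  by (simp add: level18_hauptmodul_def)

lemma one_minus_2_hauptmodul:
  assumes q: "norm q < 1" "q \<noteq> 0"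
  shows "1 - 2 * level18_hauptmodul q =
           euler_prod q ^ 2 * euler_prod (q^18) / (euler_prod (q^2) * euler_prod (q^9) ^ 2)"
proof -
  have nz: "euler_prod (q ^ n) \<noteq> 0" if "n > 0" for n
    using euler_prod_nonzero[OF norm_power_less_one[OF q(1) that]] .
  have "1 - 2 * level18_hauptmodul q =
          (euler_prod (q^9) ^ 2 / euler_prod (q^18) -
           2 * q * euler_prod (q^18) ^ 2 * euler_prod (q^3) / (euler_prod (q^6) * euler_prod (q^9))) *
          (euler_prod (q^18) / euler_prod (q^9) ^ 2)"
    using nz[of 3] nz[of 6] nz[of 9] nz[of 18]
    by (simp add: level18_hauptmodul_def field_simps power2_eq_square power3_eq_cube)
  also have "\<dots> = euler_prod q ^ 2 * euler_prod (q^18) / (euler_prod (q^2) * euler_prod (q^9) ^ 2)"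
    unfolding theta3_trisection[OF q, symmetric] by simp
  finally show ?thesis .
qed

lemma one_plus_hauptmodul:
  assumes q: "norm q < 1" "q \<noteq> 0"
  shows "1 + level18_hauptmodul q = level18_hauptmodul q *
           (euler_prod (q^2) ^ 2 * euler_prod (q^9) / (q * euler_prod q * euler_prod (q^18) ^ 2))"
proof -
  have nz: "euler_prod (q ^ n) \<noteq> 0" if "n > 0" for n
    using euler_prod_nonzero[OF norm_power_less_one[OF q(1) that]] .
  have "1 + level18_hauptmodul q = level18_hauptmodul q *
          ((euler_prod (q^9) ^ 2 * euler_prod (q^6) / (euler_prod (q^3) * euler_prod (q^18)) +
           q * euler_prod (q^18) ^ 2 / euler_prod (q^9)) * (euler_prod (q^9) / (q * euler_prod (q^18) ^ 2)))"
    using nz[of 3] nz[of 6] nz[of 9] nz[of 18] q(2)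
    by (simp add: level18_hauptmodul_def field_simps power2_eq_square power3_eq_cube)
  also have "\<dots> = level18_hauptmodul q *
           (euler_prod (q^2) ^ 2 * euler_prod (q^9) / (q * euler_prod q * euler_prod (q^18) ^ 2))"
    unfolding triangular_theta_trisection[OF q, symmetric] by simp
  finally show ?thesis .
qed

lemma cube_root_of_unity_exists: "\<exists>w::complex. w^2 + w + 1 = 0"
proof -
  define w where "w = (csqrt (- 3) - 1) / 2"
  have "csqrt (- 3) ^ 2 = (-3::complex)" by (rule power2_csqrt)
  hence "w^2 + w + 1 = 0"
    by (simp add: w_def power2_eq_square field_simps)
  thus ?thesis by blast
qed

text \<open>
  The norm of the two previous identities under \<open>q \<mapsto> \<omega>q\<close>: as \<open>u / q\<close> is a function of \<open>q\<^sup>3\<close>, the values of \<open>u\<close>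
  at \<open>q\<close>, \<open>\<omega>q\<close>, \<open>\<omega>\<^sup>2q\<close> are \<open>u\<close>, \<open>\<omega>u\<close>, \<open>\<omega>\<^sup>2u\<close>.
\<close>
lemma hauptmodul_cubes:
  assumes q: "norm q < 1" "q \<noteq> 0"
  defines "u \<equiv> level18_hauptmodul q"
  shows "1 - 8 * u^3 = euler_prod (q^3) ^ 8 * euler_prod (q^18) ^ 4 / (euler_prod (q^6) ^ 4 * euler_prod (q^9) ^ 8)"
    and "1 + u^3 = u^3 * (euler_prod (q^6) ^ 8 * euler_prod (q^9) ^ 4 / (q^3 * euler_prod (q^3) ^ 4 * euler_prod (q^18) ^ 8))"
proof -
  obtain w :: complex where w: "w^2 + w + 1 = 0" using cube_root_of_unity_exists by blast
  have w3: "w ^ 3 = 1" using w by algebra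
  hence nw: "norm w = 1" by (metis norm_one norm_power power_eq_1_iff norm_ge_zero zero_neq_numeral)
  have w0: "w \<noteq> 0" using nw by auto
  have w6: "w ^ 6 = 1" "w ^ 9 = 1" "w ^ 18 = 1" using w3 by algebra+
  have v6: "(w^2) ^ 3 = 1" "(w^2) ^ 6 = 1" "(w^2) ^ 9 = 1" "(w^2) ^ 18 = 1" using w3 by algebra+
  define a b where "a = w * q" and "b = w^2 * q"
  have ab: "norm a < 1" "a \<noteq> 0" "norm b < 1" "b \<noteq> 0"
    using q w0 nw by (auto simp: a_def b_def norm_mult norm_power)
  have ap: "a ^ 3 = q ^ 3" "a ^ 6 = q ^ 6" "a ^ 9 = q ^ 9" "a ^ 18 = q ^ 18"
    and bp: "b ^ 3 = q ^ 3" "b ^ 6 = q ^ 6" "b ^ 9 = q ^ 9" "b ^ 18 = q ^ 18"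
    by (simp_all only: a_def b_def power_mult_distrib w3 w6 v6 mult_1)
  have ua: "level18_hauptmodul a = w * u" and ub: "level18_hauptmodul b = w^2 * u"
    by (simp_all only: level18_hauptmodul_def ap bp u_def) (simp_all add: a_def b_def)
  have nz: "euler_prod (q ^ n) \<noteq> 0" if "n > 0" for n
    using euler_prod_nonzero[OF norm_power_less_one[OF q(1) that]] .
  have u0: "u \<noteq> 0" unfolding u_def by (rule hauptmodul_nonzero[OF q])
  have E1: "euler_prod q * euler_prod a * euler_prod b = euler_prod (q^3) ^ 4 / euler_prod (q^9)"
    using euler_prod_cube_roots[OF q(1) w] nz[of 9] by (simp add: a_def b_def field_simps)
  have E2: "euler_prod (q^2) * euler_prod (a^2) * euler_prod (b^2) = euler_prod (q^6) ^ 4 / euler_prod (q^18)"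
  proof -
    have "norm (q^2) < 1" by (rule norm_power_less_one) (use q in auto)
    hence "euler_prod (q^2) * euler_prod (w * q^2) * euler_prod (w^2 * q^2) * euler_prod ((q^2)^9) = euler_prod ((q^2)^3) ^ 4"
      by (rule euler_prod_cube_roots[OF _ w])
    moreover have "(w^2)^2 = w" using w3 by algebra
    hence "a^2 = w^2 * q^2" "b^2 = w * q^2"
      by (simp_all only: a_def b_def power_mult_distrib)
    ultimately show ?thesis
      using nz[of 18] by (simp add: field_simps flip: power_mult)
  qed
  have "1 - 8 * u^3 = (1 - 2 * u) * (1 - 2 * (w * u)) * (1 - 2 * (w^2 * u))"
    using w by algebra
  also have "\<dots> = (euler_prod q * euler_prod a * euler_prod b)^2 * euler_prod (q^18) ^ 3 /
        ((euler_prod (q^2) * euler_prod (a^2) * euler_prod (b^2)) * (euler_prod (q^9) ^ 2) ^ 3)"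
    using one_minus_2_hauptmodul[OF q] one_minus_2_hauptmodul[OF ab(1,2)] one_minus_2_hauptmodul[OF ab(3,4)]
    by (simp only: ua ub u_def [symmetric] ap bp)
       (simp only: power2_eq_square power3_eq_cube times_divide_times_eq mult_ac)
  also have "\<dots> = euler_prod (q^3) ^ 8 * euler_prod (q^18) ^ 4 / (euler_prod (q^6) ^ 4 * euler_prod (q^9) ^ 8)"
    unfolding E1 E2 using nz[of 9] nz[of 18] nz[of 6]
    by (simp add: field_simps flip: power_mult power_add) (simp add: power_add [symmetric] flip: power_Suc)
  finally show "1 - 8 * u^3 = euler_prod (q^3) ^ 8 * euler_prod (q^18) ^ 4 / (euler_prod (q^6) ^ 4 * euler_prod (q^9) ^ 8)" .
  have "1 + u^3 = (1 + u) * (1 + w * u) * (1 + w^2 * u)"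
    using w by algebra
  also have "\<dots> = (u * (w * u) * (w^2 * u)) * ((euler_prod (q^2) * euler_prod (a^2) * euler_prod (b^2))^2 * euler_prod (q^9) ^ 3 /
        ((q * a * b) * (euler_prod q * euler_prod a * euler_prod b) * (euler_prod (q^18) ^ 2) ^ 3))"
    using one_plus_hauptmodul[OF q] one_plus_hauptmodul[OF ab(1,2)] one_plus_hauptmodul[OF ab(3,4)]
    by (simp only: ua ub u_def [symmetric] ap bp)
       (simp only: power2_eq_square power3_eq_cube times_divide_eq_left times_divide_eq_right divide_divide_eq_left times_divide_times_eq mult_ac)
  also have "q * a * b = q^3"
    unfolding a_def b_def using w3 by algebra
  also have "u * (w * u) * (w^2 * u) = u^3"
    using w3 by algebra
  also have "u^3 * ((euler_prod (q^2) * euler_prod (a^2) * euler_prod (b^2))^2 * euler_prod (q^9) ^ 3 /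
        (q^3 * (euler_prod q * euler_prod a * euler_prod b) * (euler_prod (q^18) ^ 2) ^ 3)) =
      u^3 * (euler_prod (q^6) ^ 8 * euler_prod (q^9) ^ 4 / (q^3 * euler_prod (q^3) ^ 4 * euler_prod (q^18) ^ 8))"
    unfolding E1 E2 using nz[of 9] nz[of 18] nz[of 3] q(2)
    by (simp add: field_simps flip: power_mult power_add) (simp add: power_add [symmetric] flip: power_Suc)
  finally show "1 + u^3 = u^3 * (euler_prod (q^6) ^ 8 * euler_prod (q^9) ^ 4 / (q^3 * euler_prod (q^3) ^ 4 * euler_prod (q^18) ^ 8))" .
qed

text \<open>
  Inserting the eta quotients for \<open>1 - 2u\<close>, \<open>1 + u\<close>, \<open>1 - 8u\<^sup>3\<close>, \<open>1 + u\<^sup>3\<close> and \<open>u\<close>; all Euler products at \<open>q\<^sup>3\<close>, \<open>q\<^sup>6\<close>,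
  \<open>q\<^sup>9\<close>, \<open>q\<^sup>1\<^sup>8\<close> cancel. The exponent 8 makes the powers of \<open>E(q)\<close> and \<open>E(q\<^sup>2)\<close> equal to those of \<open>h\<close>.
\<close>
lemma eta_quotient_hauptmodul:
  assumes q: "norm q < 1" "q \<noteq> 0"
  defines "u \<equiv> level18_hauptmodul q"
  shows "(1 - 2 * u) ^ 8 * (1 - 8 * u^3) = euler_prod q ^ 24 / (q * euler_prod (q^2) ^ 24) * (u * (1 + u) ^ 8 * (1 + u^3))"
    and "u * (1 + u) ^ 8 * (1 + u^3) \<noteq> 0"
proof -
  define e where "e = (\<lambda>n. euler_prod (q ^ n))"
  have nz: "e n \<noteq> 0" if "n > 0" for n
    unfolding e_def using euler_prod_nonzero[OF norm_power_less_one[OF q(1) that]] .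
  have u: "u = q * e 3 * e 18 ^ 3 / (e 6 * e 9 ^ 3)"
    by (simp add: u_def level18_hauptmodul_def e_def)
  have u0: "u \<noteq> 0" unfolding u_def by (rule hauptmodul_nonzero[OF q])
  have f1: "1 - 2 * u = e 1 ^ 2 * e 18 / (e 2 * e 9 ^ 2)"
    using one_minus_2_hauptmodul[OF q] by (simp add: u_def e_def)
  have f2: "1 + u = u * (e 2 ^ 2 * e 9 / (q * e 1 * e 18 ^ 2))"
    using one_plus_hauptmodul[OF q] by (simp add: u_def e_def)
  have f3: "1 - 8 * u^3 = e 3 ^ 8 * e 18 ^ 4 / (e 6 ^ 4 * e 9 ^ 8)"
    using hauptmodul_cubes(1)[OF q] by (simp add: u_def e_def)
  have f4: "1 + u^3 = u^3 * (e 6 ^ 8 * e 9 ^ 4 / (q^3 * e 3 ^ 4 * e 18 ^ 8))"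
    using hauptmodul_cubes(2)[OF q] by (simp add: u_def e_def)
  show "u * (1 + u) ^ 8 * (1 + u^3) \<noteq> 0"
    unfolding f2 f4 using u0 nz q(2) by simp
  have "u * (1 + u) ^ 8 * (1 + u^3) =
          u ^ 12 * ((e 2 ^ 2 * e 9 / (q * e 1 * e 18 ^ 2)) ^ 8 * (e 6 ^ 8 * e 9 ^ 4 / (q^3 * e 3 ^ 4 * e 18 ^ 8)))"
    unfolding f2 f4 by (simp add: power_mult_distrib eval_nat_numeral mult_ac)
  also have "\<dots> = q * e 3 ^ 8 * e 18 ^ 12 * e 2 ^ 16 / (e 6 ^ 4 * e 9 ^ 24 * e 1 ^ 8)"
    unfolding u using nz q(2)
    by (simp add: power_mult_distrib power_divide flip: power_mult)
       (simp add: divide_simps, simp add: eval_nat_numeral mult_ac)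
  finally have B: "u * (1 + u) ^ 8 * (1 + u^3) = q * e 3 ^ 8 * e 18 ^ 12 * e 2 ^ 16 / (e 6 ^ 4 * e 9 ^ 24 * e 1 ^ 8)" .
  have A: "(1 - 2 * u) ^ 8 * (1 - 8 * u^3) = e 1 ^ 16 * e 3 ^ 8 * e 18 ^ 12 / (e 2 ^ 8 * e 6 ^ 4 * e 9 ^ 24)"
    unfolding f1 f3 by (simp add: power_mult_distrib power_divide mult_ac flip: power_mult power_add)
  define X Y V W where "X = e 1 ^ 16" and "Y = e 1 ^ 8" and "V = e 2 ^ 8" and "W = e 2 ^ 16"
  have XYVW: "e 1 ^ 24 = X * Y" "e 2 ^ 24 = V * W"
    by (simp_all add: X_def Y_def V_def W_def flip: power_add)
  have nz': "Y \<noteq> 0" "V \<noteq> 0" "W \<noteq> 0"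
    using nz by (auto simp: Y_def V_def W_def)
  have "e 1 ^ 24 / (q * e 2 ^ 24) * (u * (1 + u) ^ 8 * (1 + u^3)) = (1 - 2 * u) ^ 8 * (1 - 8 * u^3)"
    unfolding A B XYVW X_def [symmetric] Y_def [symmetric] V_def [symmetric] W_def [symmetric]
    using nz' q(2) by (simp add: mult.assoc)
  thus "(1 - 2 * u) ^ 8 * (1 - 8 * u^3) = euler_prod q ^ 24 / (q * euler_prod (q^2) ^ 24) * (u * (1 + u) ^ 8 * (1 + u^3))"
    by (simp add: e_def)
qed

section \<open>Periodic holomorphic functions on an annulus\<close>

definition annulus :: "complex \<Rightarrow> complex set" where
  "annulus p = {x. norm p < norm x \<and> norm x < 1 / norm p}"

lemma open_annulus: "open (annulus p)"
  unfolding annulus_def by (intro open_Collect_conj open_Collect_less continuous_intros)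

lemma connected_annulus': "connected (annulus p)"
  using connected_annulus(1)[where a = "0::complex" and ?r1.0 = "norm p" and ?r2.0 = "1 / norm p"]
  by (simp add: annulus_def)

text \<open>
  Multiplication by \<open>p\<close> or its inverse moves every point of the annulus into the compact
  part \<open>|p|^(1/2) \<le> |x| \<le> |p|^(-1/2)\<close>, or the point lies there already. The modulus of \<open>f\<close> therefore attains its
  maximum over the whole open annulus, and the maximum modulus principle applies. This is
  Liouville's theorem for elliptic functions, with the annulus as fundamental region.
\<close>
lemma periodic_holomorphic_constant:
  assumes p: "p \<noteq> 0" "norm p < 1"
    and hol: "f holomorphic_on annulus p"
    and per: "\<And>x. 1 < norm x \<Longrightarrow> norm x < 1 / norm p \<Longrightarrow> f (p * x) = f x"
  shows "f constant_on annulus p"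
proof -
  define r where "r = sqrt (norm p)"
  have r: "0 < r" "r < 1" "r * r = norm p" using p by (auto simp: r_def)
  have "r * r < r * 1" using r(1,2) by (intro mult_strict_left_mono)
  hence pr: "norm p < r" "1 / r < 1 / norm p" "1 < 1 / r"
    using r p by (auto simp: field_simps)
  define B where "B = {x::complex. r \<le> norm x \<and> norm x \<le> 1 / r}"
  have BA: "B \<subseteq> annulus p" using pr by (auto simp: B_def annulus_def)
  have "compact B"
  proof (rule compact_eq_bounded_closed[THEN iffD2], intro conjI)
    show "bounded B" by (rule boundedI[of _ "1 / r"]) (auto simp: B_def)
    show "closed B" unfolding B_def
      by (intro closed_Collect_conj closed_Collect_le continuous_intros)
  qed
  moreover have "1 \<in> B" using r pr by (auto simp: B_def)
  hence "B \<noteq> {}" by blast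
  moreover have "continuous_on B (\<lambda>x. norm (f x))"
    using holomorphic_on_imp_continuous_on[OF holomorphic_on_subset[OF hol BA]]
    by (intro continuous_intros)
  ultimately obtain \<xi> where \<xi>: "\<xi> \<in> B" "\<And>x. x \<in> B \<Longrightarrow> norm (f x) \<le> norm (f \<xi>)"
    using continuous_attains_sup[of B "\<lambda>x. norm (f x)"] by blast
  have "norm (f z) \<le> norm (f \<xi>)" if z: "z \<in> annulus p" for z
  proof -
    consider "z \<in> B" | "norm z > 1 / r" | "norm z < r" by (force simp: B_def)
    thus ?thesis
    proof cases
      case 2
      have "r = norm p * (1 / r)" using r p by (simp add: field_simps)
      also have "\<dots> \<le> norm p * norm z" using 2 by (intro mult_left_mono) auto
      finally have "r \<le> norm (p * z)" by (simp add: norm_mult)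
      moreover have "norm (p * z) < 1"
        using z p by (simp add: annulus_def norm_mult field_simps)
      ultimately have "p * z \<in> B" using pr by (auto simp: B_def)
      moreover have "f (p * z) = f z"
        using 2 pr z by (intro per) (auto simp: annulus_def)
      ultimately show ?thesis using \<xi>(2) by metis
    next
      case 3
      have n: "1 < norm (z / p)" using z p by (simp add: annulus_def norm_divide field_simps)
      have "norm (z / p) < r / norm p"
        using 3 p by (simp add: norm_divide divide_strict_right_mono)
      also have "r / norm p = 1 / r" using r p by (simp add: field_simps)
      finally have n2: "norm (z / p) < 1 / r" .
      have "z / p \<in> B" using n n2 r by (auto simp: B_def)
      moreover have "f (p * (z / p)) = f (z / p)"
        using n n2 pr by (intro per) auto
      ultimately show ?thesis using \<xi>(2)[of "z / p"] p by simp
    qed (use \<xi> in auto)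
  qed
  thus ?thesis
    using BA \<xi>(1)
    by (intro maximum_modulus_principle[OF hol open_annulus connected_annulus' open_annulus order_refl, of \<xi>]) auto
qed

section \<open>Lambert series\<close>

text \<open>
  The operator \<open>x d/dx\<close> multiplies the \<open>n\<close>-th coefficient by \<open>n\<close>. Derivatives are stated in the form
  \<open>G x / x\<close> throughout, so that \<open>G\<close> is the image under this operator.
\<close>
lemma euler_operator_power_series:
  fixes c :: "nat \<Rightarrow> complex"
  assumes sum: "\<And>x. norm x < K \<Longrightarrow> summable (\<lambda>n. c n * x ^ n)" and x: "norm x < K"
  shows "summable (\<lambda>n. of_nat n * c n * x ^ n)"
    and "x \<noteq> 0 \<Longrightarrow> ((\<lambda>x. \<Sum>n. c n * x ^ n) has_field_derivative (\<Sum>n. of_nat n * c n * x ^ n) / x) (at x)"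
proof -
  have s: "summable (\<lambda>n. diffs c n * x ^ n)"
    by (rule termdiff_converges[OF x sum])
  have "(\<lambda>n. x * (diffs c n * x ^ n)) sums (x * (\<Sum>n. diffs c n * x ^ n))"
    by (intro sums_mult summable_sums s)
  also have "(\<lambda>n. x * (diffs c n * x ^ n)) = (\<lambda>n. of_nat (Suc n) * c (Suc n) * x ^ Suc n)"
    by (simp add: diffs_def fun_eq_iff)
  finally have *: "(\<lambda>n. of_nat n * c n * x ^ n) sums (x * (\<Sum>n. diffs c n * x ^ n))"
    by (subst (asm) sums_Suc_iff) simp
  thus "summable (\<lambda>n. of_nat n * c n * x ^ n)" by (rule sums_summable)
  show "((\<lambda>x. \<Sum>n. c n * x ^ n) has_field_derivative (\<Sum>n. of_nat n * c n * x ^ n) / x) (at x)" if "x \<noteq> 0"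
  proof -
    have "(\<Sum>n. of_nat n * c n * x ^ n) / x = (\<Sum>n. diffs c n * x ^ n)"
      using that by (simp add: sums_unique[OF *, symmetric])
    thus ?thesis using termdiffs_strong'[OF sum x] by simp
  qed
qed

text \<open>
  The term for \<open>n = 0\<close> vanishes also when \<open>k = 0\<close>, because division by \<open>0\<close> yields \<open>0\<close>; hence \<open>x d/dx\<close> maps
  the function for \<open>k\<close> to that for \<open>k + 1\<close> without exception.
\<close>
definition lambert :: "complex \<Rightarrow> nat \<Rightarrow> complex \<Rightarrow> complex" where
  "lambert p k x = (\<Sum>n. of_nat n ^ k * (p ^ n / (1 - p ^ n)) * x ^ n)"

lemma summable_lambert:
  fixes p x :: complex
  assumes p: "p \<noteq> 0" "norm p < 1" and x: "norm x < 1 / norm p"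
  shows "summable (\<lambda>n. of_nat n ^ k * (p ^ n / (1 - p ^ n)) * x ^ n)"
  using x
proof (induction k arbitrary: x)
  case (0 x)
  show ?case
  proof (rule summable_comparison_test')
    show "summable (\<lambda>n. (1 / (1 - norm p)) * (norm (p * x)) ^ n)"
      using 0 p by (intro summable_mult summable_geometric) (auto simp: norm_mult field_simps)
    fix n :: nat
    assume n: "n \<ge> 1"
    have "norm p ^ n \<le> norm p ^ 1" using n p by (intro power_decreasing) auto
    hence "1 - norm p \<le> norm (1 - p ^ n)"
      using norm_triangle_ineq2[of 1 "p ^ n"] by (simp add: norm_power)
    hence "norm (p ^ n / (1 - p ^ n)) \<le> norm p ^ n / (1 - norm p)"
      using p by (simp add: norm_divide norm_power frac_le)
    hence "norm (p ^ n / (1 - p ^ n)) * norm x ^ n \<le> norm p ^ n / (1 - norm p) * norm x ^ n"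
      by (rule mult_right_mono) auto
    thus "norm (of_nat n ^ 0 * (p ^ n / (1 - p ^ n)) * x ^ n) \<le> (1 / (1 - norm p)) * (norm (p * x)) ^ n"
      by (simp add: norm_mult norm_divide norm_power power_mult_distrib)
  qed
next
  case (Suc k x)
  show ?case
    using euler_operator_power_series(1)[OF Suc.IH Suc.prems] by (simp add: mult_ac)
qed

lemma lambert_deriv:
  assumes p: "p \<noteq> 0" "norm p < 1" and x: "norm x < 1 / norm p" "x \<noteq> 0"
  shows "(lambert p k has_field_derivative lambert p (Suc k) x / x) (at x)"
  using euler_operator_power_series(2)[OF summable_lambert[OF p] x, of k]
  by (simp add: lambert_def [abs_def] mult_ac)

lemma sums_n_power:
  fixes y :: complex
  assumes "norm y < 1"
  shows "(\<lambda>n. of_nat n * y ^ n) sums (y / (1 - y)^2)"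
proof -
  have "(\<lambda>n. y * (of_nat (Suc n) * y ^ n)) sums (y * (1 / (1 - y)^2))"
    by (intro sums_mult geometric_deriv_sums assms)
  hence "(\<lambda>n. of_nat (Suc n) * y ^ Suc n) sums (y / (1 - y)^2)"
    by (simp add: mult_ac)
  thus ?thesis by (subst (asm) sums_Suc_iff) simp
qed

text \<open>
  The first two applications of \<open>x d/dx\<close> to the rational part of the Weierstrass function.
\<close>
lemma theta_derivs_rational:
  fixes y :: complex
  assumes "y \<noteq> 1" "y \<noteq> 0"
  shows "((\<lambda>y. y / (1 - y)^2) has_field_derivative (y * (1 + y) / (1 - y)^3) / y) (at y)"
    and "((\<lambda>y. y * (1 + y) / (1 - y)^3) has_field_derivative (y * (1 + 4 * y + y^2) / (1 - y)^4) / y) (at y)"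
proof -
  have z: "1 - y \<noteq> 0" using assms by simp
  have "((\<lambda>y. y / (1 - y)^2) has_field_derivative (1 * (1 - y)^2 - y * (2 * (1 - y) * (-1))) / ((1 - y)^2 * (1 - y)^2)) (at y)"
    by (rule derivative_eq_intros refl | use z in \<open>simp; fail\<close>)+
  also have "(1 * (1 - y)^2 - y * (2 * (1 - y) * (-1))) / ((1 - y)^2 * (1 - y)^2) = (y * (1 + y) / (1 - y)^3) / y"
    using z assms by (simp add: divide_simps) algebra
  finally show "((\<lambda>y. y / (1 - y)^2) has_field_derivative (y * (1 + y) / (1 - y)^3) / y) (at y)" .
  have "((\<lambda>y. y * (1 + y) / (1 - y)^3) has_field_derivative ((1 + 2 * y) * (1 - y)^3 - y * (1 + y) * (3 * (1 - y)^2 * (-1))) / ((1 - y)^3 * (1 - y)^3)) (at y)"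
    by (rule derivative_eq_intros refl | use z in \<open>simp add: algebra_simps; fail\<close>)+
  also have "((1 + 2 * y) * (1 - y)^3 - y * (1 + y) * (3 * (1 - y)^2 * (-1))) / ((1 - y)^3 * (1 - y)^3) = (y * (1 + 4 * y + y^2) / (1 - y)^4) / y"
    using z assms by (simp add: divide_simps) algebra
  finally show "((\<lambda>y. y * (1 + y) / (1 - y)^3) has_field_derivative (y * (1 + 4 * y + y^2) / (1 - y)^4) / y) (at y)" .
qed

lemma sums_n3_power:
  fixes y :: complex
  assumes y: "norm y < 1" "y \<noteq> 0"
  shows "(\<lambda>n. of_nat n ^ 3 * y ^ n) sums (y * (1 + 4 * y + y^2) / (1 - y)^4)"
proof -
  have s1: "summable (\<lambda>n. of_nat n * x ^ n)" and e1: "(\<Sum>n. of_nat n * x ^ n) = x / (1 - x)^2"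
    if "norm x < 1" for x :: complex
    using sums_n_power[OF that] sums_unique sums_summable by force+
  have op: "open (ball (0::complex) 1 - {0})" by auto
  have s2: "summable (\<lambda>n. of_nat n * of_nat n * x ^ n)" if "norm x < 1" for x :: complex
    using euler_operator_power_series(1)[OF s1 that] .
  have e2: "(\<Sum>n. of_nat n * of_nat n * x ^ n) = x * (1 + x) / (1 - x)^3" if "norm x < 1" "x \<noteq> 0" for x :: complex
  proof -
    have "((\<lambda>x. x / (1 - x)^2) has_field_derivative (\<Sum>n. of_nat n * of_nat n * x ^ n) / x) (at x)"
      by (rule has_field_derivative_transform_within_open[OF euler_operator_power_series(2)[OF s1 that] op])
         (use that e1 in auto)
    moreover have "x \<noteq> 1" using that by auto
    ultimately have "(\<Sum>n. of_nat n * of_nat n * x ^ n) / x = (x * (1 + x) / (1 - x)^3) / x"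
      using DERIV_unique theta_derivs_rational(1) that by blast
    thus ?thesis using that by (simp only: divide_cancel_right) simp
  qed
  have "((\<lambda>x. x * (1 + x) / (1 - x)^3) has_field_derivative (\<Sum>n. of_nat n * (of_nat n * of_nat n) * y ^ n) / y) (at y)"
    by (rule has_field_derivative_transform_within_open[OF euler_operator_power_series(2)[OF s2 y] op])
       (use y e2 in auto)
  moreover have "y \<noteq> 1" using y by auto
  ultimately have "(\<Sum>n. of_nat n * (of_nat n * of_nat n) * y ^ n) / y = (y * (1 + 4 * y + y^2) / (1 - y)^4) / y"
    using DERIV_unique theta_derivs_rational(2) y(2) by blast
  hence "(\<Sum>n. of_nat n * (of_nat n * of_nat n) * y ^ n) = y * (1 + 4 * y + y^2) / (1 - y)^4"
    using y(2) by (simp only: divide_cancel_right) simp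
  with euler_operator_power_series(1)[OF s2 y(1)] show ?thesis
    by (simp add: power3_eq_cube mult.assoc sums_iff)
qed

text \<open>
  Coefficientwise \<open>(1 - p^n) / (1 - p^n)\<close> cancels and leaves \<open>\<Sum> n (p x)^n\<close>.
\<close>
lemma lambert_functional_eq:
  assumes p: "p \<noteq> 0" "norm p < 1" and x: "norm x < 1 / norm p"
  shows "lambert p 1 x - lambert p 1 (p * x) = p * x / (1 - p * x)^2"
proof -
  have px: "norm (p * x) < 1" using x p by (simp add: norm_mult field_simps)
  have "1 < 1 / norm p" using p by (simp add: field_simps)
  hence px': "norm (p * x) < 1 / norm p" using px by linarith
  have "lambert p 1 x - lambert p 1 (p * x) =
          (\<Sum>n. of_nat n ^ 1 * (p ^ n / (1 - p ^ n)) * x ^ n - of_nat n ^ 1 * (p ^ n / (1 - p ^ n)) * (p * x) ^ n)"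
    unfolding lambert_def
    by (rule suminf_diff) (use summable_lambert[OF p, of x 1] summable_lambert[OF p, of "p * x" 1] x px' in auto)
  also have "\<dots> = (\<Sum>n. of_nat n * (p * x) ^ n)"
  proof (rule suminf_cong)
    fix n
    show "of_nat n ^ 1 * (p ^ n / (1 - p ^ n)) * x ^ n - of_nat n ^ 1 * (p ^ n / (1 - p ^ n)) * (p * x) ^ n = of_nat n * (p * x) ^ n"
    proof (cases "n = 0")
      case False
      have "norm (p ^ n) < 1" using p False by (simp add: norm_power power_less_one_iff)
      hence "1 - p ^ n \<noteq> 0" by auto
      thus ?thesis by (simp add: power_mult_distrib divide_simps) algebra
    qed auto
  qed
  also have "\<dots> = p * x / (1 - p * x)^2"
    using sums_n_power[OF px] sums_unique by metis
  finally show ?thesis .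
qed

section \<open>The Weierstrass function and theta functions\<close>

text \<open>
  The theta function \<open>\<Prod>n\<ge>0. (1 - x p^n) (1 - p^(n+1) / x)\<close> divided by \<open>1 - x\<close>. Without the zero at
  \<open>x = 1\<close> the function is invariant under \<open>x \<mapsto> 1 / x\<close> and has no zeros in the annulus.
\<close>
definition theta_core :: "complex \<Rightarrow> complex \<Rightarrow> complex" where
  "theta_core p x = qpoch (p * x) p * qpoch (p / x) p"

lemma theta_core_inverse: "theta_core p (1 / x) = theta_core p x"
  by (simp add: theta_core_def mult.commute)

lemma theta_core_nonzero:
  assumes "p \<noteq> 0" "norm p < 1" "x \<in> annulus p"
  shows "theta_core p x \<noteq> 0"
proof -
  have "x \<noteq> 0" using assms by (auto simp: annulus_def)
  hence "norm (p * x) < 1" "norm (p / x) < 1"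
    using assms by (auto simp: annulus_def norm_mult norm_divide field_simps)
  thus ?thesis
    using qpoch_nonzero[OF assms(2)] by (simp add: theta_core_def)
qed

text \<open>
  Kept in multiplied-out form, so that it also holds at the zeros of the two linear factors.
\<close>
lemma theta_core_shift:
  assumes "p \<noteq> 0" "norm p < 1" "x \<noteq> 0"
  shows "(1 - p * x) * theta_core p (p * x) = (1 - 1 / x) * theta_core p x"
proof -
  have "qpoch (p * x) p = (1 - p * x) * qpoch (p * (p * x)) p"
    by (rule qpoch_unfold[OF assms(2)])
  moreover have "qpoch (1 / x) p = (1 - 1 / x) * qpoch (p * (1 / x)) p"
    by (rule qpoch_unfold[OF assms(2)])
  ultimately show ?thesis
    using assms(1) by (simp add: theta_core_def)
qed

lemma theta_core_holomorphic [holomorphic_intros]: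
  assumes "norm p < 1" "f holomorphic_on A" "\<And>x. x \<in> A \<Longrightarrow> f x \<noteq> 0"
  shows "(\<lambda>x. theta_core p (f x)) holomorphic_on A"
proof -
  have q: "(\<lambda>x. qpoch (g x) p) holomorphic_on A" if "g holomorphic_on A" for g
    using holomorphic_on_compose[OF that qpoch_holomorphic[OF assms(1)]] by (simp add: o_def)
  show ?thesis
    unfolding theta_core_def using assms(2,3) by (intro holomorphic_intros q) auto
qed

text \<open>
  Up to scaling and an additive constant, the Weierstrass function in the variable \<open>x = e^z\<close> for the lattice
  spanned by \<open>2 \<pi> \<i>\<close> and \<open>log p\<close>, that is, \<open>\<Sum>n\<in>\<int>. x p^n / (1 - x p^n)^2\<close>. The term for \<open>n = 0\<close> is
  kept apart and the others are expanded into Lambert series, which converge on the whole annulus.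
\<close>
definition wp :: "complex \<Rightarrow> complex \<Rightarrow> complex" where
  "wp p x = x / (1 - x)^2 + lambert p 1 x + lambert p 1 (1 / x)"

lemma lambert_holomorphic:
  assumes "p \<noteq> 0" "norm p < 1" "g holomorphic_on A" "\<And>x. x \<in> A \<Longrightarrow> norm (g x) < 1 / norm p" "0 \<notin> g ` A"
  shows "(\<lambda>x. lambert p k (g x)) holomorphic_on A"
proof -
  have "lambert p k holomorphic_on g ` A"
    unfolding holomorphic_on_def field_differentiable_def
    using lambert_deriv[OF assms(1,2)] assms(4,5) has_field_derivative_at_within by fastforce
  from holomorphic_on_compose[OF assms(3) this] show ?thesis by (simp add: o_def)
qed

text \<open>
  The two Lambert series change by exactly the rational terms that are needed to turn
  \<open>x / (1 - x)\<^sup>2\<close> into its value at \<open>p x\<close>.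
\<close>
lemma wp_periodic:
  assumes p: "p \<noteq> 0" "norm p < 1" and x: "1 < norm x" "norm x < 1 / norm p"
  shows "wp p (p * x) = wp p x"
proof -
  have x0: "x \<noteq> 0" "1 - x \<noteq> 0" using x by auto
  have "norm (1 / (p * x)) < 1 / norm p"
  proof -
    have "1 / norm x < 1" using x by (simp add: divide_less_eq)
    hence "1 / norm x / norm p < 1 / norm p" using p by (intro divide_strict_right_mono) auto
    thus ?thesis by (simp add: norm_divide norm_mult mult.commute)
  qed
  from lambert_functional_eq[OF p this] lambert_functional_eq[OF p x(2)]
  have "lambert p 1 (1 / (p * x)) - lambert p 1 (1 / x) = (1 / x) / (1 - 1 / x)^2"
    and "lambert p 1 x - lambert p 1 (p * x) = p * x / (1 - p * x)^2"
    using p by simp_all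
  moreover have "(1 / x) / (1 - 1 / x)^2 = x / (1 - x)^2"
    using x0 by (simp add: divide_simps) (simp add: algebra_simps power2_eq_square)
  ultimately show ?thesis unfolding wp_def by (simp add: algebra_simps)
qed

text \<open>
  The classical formula \<open>\<wp>(a) - \<wp>(b) = - \<sigma>(a + b) \<sigma>(a - b) / (\<sigma>(a)\<^sup>2 \<sigma>(b)\<^sup>2)\<close>. The difference of the two sides is
  invariant under \<open>x \<mapsto> p x\<close> and its only possible singularity in the annulus is at \<open>x = 1\<close>. There, both
  sides have a double pole with the same leading coefficient, and invariance under \<open>x \<mapsto> 1 / x\<close> excludes
  a simple pole. Thus the difference is constant, and it vanishes at \<open>x = y\<close>.
\<close>
theorem wp_difference:
  assumes p: "p \<noteq> 0" "norm p < 1" and y: "y \<in> annulus p" "y \<noteq> 1" and x: "x \<in> annulus p" "x \<noteq> 1"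
  shows "wp p x - wp p y =
           theta_core p 1 ^ 2 / ((2 - (y + 1 / y)) * theta_core p y ^ 2) *
           ((x + 1 / x) - (y + 1 / y)) * theta_core p (x * y) * theta_core p (x / y) /
           ((x + 1 / x - 2) * theta_core p x ^ 2)"
proof -
  define S where "S = theta_core p"
  define C where "C = S 1 ^ 2 / ((2 - (y + 1 / y)) * S y ^ 2)"
  define R where "R = (\<lambda>x. C * ((x + 1 / x) - (y + 1 / y)) * S (x * y) * S (x / y) / ((x + 1 / x - 2) * S x ^ 2))"
  define E where "E = (\<lambda>x. wp p x - wp p y - R x)"
  have y0: "y \<noteq> 0" using y p by (auto simp: annulus_def)
  have one: "1 \<in> annulus p" using p by (auto simp: annulus_def field_simps)
  have Snz: "S z \<noteq> 0" if "z \<in> annulus p" for z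
    using theta_core_nonzero[OF p that] by (simp add: S_def)
  have X2: "z + 1 / z - 2 = (z - 1)^2 / z" if "z \<noteq> 0" for z :: complex
    using that by (simp add: field_simps power2_eq_square)
  have Y2: "2 - (y + 1 / y) \<noteq> 0"
    using X2[OF y0] y0 y(2) by (metis divide_eq_0_iff eq_iff_diff_eq_0 minus_diff_eq neg_equal_0_iff_equal power_eq_0_iff)
  have E_per: "E (p * x) = E x" if x: "1 < norm x" "norm x < 1 / norm p" for x
  proof -
    have x0: "x \<noteq> 0" using x by auto
    have px: "norm (p * x) < 1" using x p by (simp add: norm_mult field_simps)
    hence px1: "1 - p * x \<noteq> 0" by auto
    have sh: "(1 - p * z) * S (p * z) = (1 - 1 / z) * S z" if "z \<noteq> 0" for z
      unfolding S_def by (rule theta_core_shift[OF p that])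
    have num: "((p * x + 1 / (p * x)) - (y + 1 / y)) * S (p * x * y) * S (p * x / y) =
            ((x + 1 / x) - (y + 1 / y)) * S (x * y) * S (x / y) / (p * x^2)"
    proof -
      have "((p * x + 1 / (p * x)) - (y + 1 / y)) = (1 - p * (x * y)) * (1 - p * (x / y)) / (p * x)"
        using p x0 y0 by (simp add: field_simps)
      hence "((p * x + 1 / (p * x)) - (y + 1 / y)) * S (p * x * y) * S (p * x / y) =
             ((1 - p * (x * y)) * S (p * (x * y))) * ((1 - p * (x / y)) * S (p * (x / y))) / (p * x)"
        by (simp add: mult_ac)
      also have "\<dots> = (1 - 1 / (x * y)) * S (x * y) * ((1 - 1 / (x / y)) * S (x / y)) / (p * x)"
        using sh[of "x * y"] sh[of "x / y"] x0 y0 by simp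
      also have "\<dots> = ((1 - 1 / (x * y)) * (1 - 1 / (x / y))) * S (x * y) * S (x / y) / (p * x)"
        by (simp add: mult_ac)
      also have "(1 - 1 / (x * y)) * (1 - 1 / (x / y)) = ((x + 1 / x) - (y + 1 / y)) / x"
        using x0 y0 by (simp add: field_simps)
      finally show ?thesis by (simp add: power2_eq_square mult_ac)
    qed
    have den: "(p * x + 1 / (p * x) - 2) * S (p * x) ^ 2 = (x + 1 / x - 2) * S x ^ 2 / (p * x^2)"
    proof -
      have "(p * x + 1 / (p * x) - 2) * S (p * x) ^ 2 = ((1 - p * x) * S (p * x)) ^ 2 / (p * x)"
        using X2[of "p * x"] p x0 by (simp add: power_mult_distrib power2_commute)
      also have "\<dots> = (1 - 1 / x)^2 * S x ^ 2 / (p * x)"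
        unfolding sh[OF x0] by (simp add: power_mult_distrib)
      also have "(1 - 1 / x)^2 = (x + 1 / x - 2) / x"
        using x0 by (simp add: field_simps power2_eq_square)
      finally show ?thesis by (simp add: power2_eq_square mult_ac)
    qed
    have "R (p * x) = C * (((p * x + 1 / (p * x)) - (y + 1 / y)) * S (p * x * y) * S (p * x / y)) /
            ((p * x + 1 / (p * x) - 2) * S (p * x) ^ 2)"
      by (simp add: R_def mult_ac)
    also have "\<dots> = R x"
      unfolding num den R_def using p x0 by (simp add: mult_ac)
    finally show ?thesis using wp_periodic[OF p x] by (simp add: E_def)
  qed
  \<comment> \<open>\<open>M\<close> is the numerator that must vanish to second order at \<open>1\<close>: \<open>C\<close> is chosen such that \<open>M 1 = 0\<close>,
      and \<open>M (1 / x) = M x\<close> forces the derivative at \<open>1\<close> to vanish.\<close>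
  define M where "M = (\<lambda>x. S x ^ 2 - C * ((x + 1 / x) - (y + 1 / y)) * S (x * y) * S (x / y))"
  have Shol: "S holomorphic_on -{0}"
    unfolding S_def using theta_core_holomorphic[OF p(2), of "\<lambda>x. x" "-{0}"] by simp
  have M_hol: "M holomorphic_on -{0}"
    unfolding M_def S_def using p y0 by (intro holomorphic_intros) auto
  have M1: "M 1 = 0"
  proof -
    have "S (1 / y) = S y" unfolding S_def by (rule theta_core_inverse)
    hence "M 1 = S 1 ^ 2 - C * ((2 - (y + 1 / y)) * S y ^ 2)"
      by (simp add: M_def power2_eq_square mult_ac)
    also have "\<dots> = 0" unfolding C_def using Y2 Snz[OF y(1)] by simp
    finally show ?thesis .
  qed
  have M_inv: "M (1 / x) = M x" for x
  proof -
    have "S (1 / x * y) = S (x / y)" "S (1 / x / y) = S (x * y)" "S (1 / x) = S x"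
      using theta_core_inverse[of p "x / y"] theta_core_inverse[of p "x * y"] theta_core_inverse[of p x]
      by (simp_all add: S_def)
    thus ?thesis by (simp add: M_def mult_ac add_ac)
  qed
  have op: "open (-{0::complex})" by auto
  have dM: "deriv M 1 = 0"
  proof -
    have d: "(M has_field_derivative deriv M 1) (at 1)"
      by (rule holomorphic_derivI[OF M_hol op]) auto
    have "((\<lambda>x. M (1 / x)) has_field_derivative deriv M 1 * (-1)) (at 1)"
      by (rule DERIV_chain2[where g = "\<lambda>x::complex. 1 / x"]) (use d in \<open>auto intro!: derivative_eq_intros\<close>)
    hence "(M has_field_derivative deriv M 1 * (-1)) (at 1)" by (simp add: M_inv)
    from DERIV_unique[OF this d] show ?thesis by simp
  qed
  define K where "K = (\<lambda>x. if x = 1 then deriv M 1 else (M x - M 1) / (x - 1))"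
  have K_hol: "K holomorphic_on -{0}"
    unfolding K_def by (rule pole_lemma_open[OF M_hol op])
  define L where "L = (\<lambda>x. if x = 1 then deriv K 1 else (K x - K 1) / (x - 1))"
  have L_hol: "L holomorphic_on -{0}"
    unfolding L_def by (rule pole_lemma_open[OF K_hol op])
  have M_factor: "M x = (x - 1)^2 * L x" if "x \<noteq> 1" for x
    using that by (simp add: L_def K_def M1 dM power2_eq_square)
  \<comment> \<open>The holomorphic continuation of \<open>E\<close> to the point \<open>1\<close>\<close>
  define E' where "E' = (\<lambda>x. lambert p 1 x + lambert p 1 (1 / x) - wp p y + x * L x / S x ^ 2)"
  have EE': "E x = E' x" if "x \<in> annulus p" "x \<noteq> 1" for x
  proof -
    have x0: "x \<noteq> 0" "x - 1 \<noteq> 0" using that p by (auto simp: annulus_def)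
    have "x * L x / S x ^ 2 = x * M x / ((x - 1)^2 * S x ^ 2)"
      using M_factor[OF that(2)] x0 by simp
    also have "\<dots> = x / (x - 1)^2 - R x"
      using x0 Snz[OF that(1)] unfolding R_def M_def X2[OF x0(1)]
      by (simp add: right_diff_distrib diff_divide_distrib mult_ac)
    finally show ?thesis by (simp add: E_def E'_def wp_def power2_commute)
  qed
  have "E' holomorphic_on annulus p"
    unfolding E'_def
  proof (intro holomorphic_intros lambert_holomorphic[OF p])
    have sub: "annulus p \<subseteq> -{0}" using p by (auto simp: annulus_def)
    show "L holomorphic_on annulus p" "S holomorphic_on annulus p"
      using L_hol Shol holomorphic_on_subset sub by blast+
    show "norm (1 / z) < 1 / norm p" if "z \<in> annulus p" for z
      using that p by (auto simp: annulus_def norm_divide intro!: divide_strict_left_mono mult_pos_pos)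
  qed (use p Snz in \<open>auto simp: annulus_def\<close>)
  moreover have "E' (p * x) = E' x" if x: "1 < norm x" "norm x < 1 / norm p" for x
  proof -
    have "norm p * 1 < norm p * norm x" using x p by (intro mult_strict_left_mono) auto
    moreover have px: "norm (p * x) < 1" using x p by (simp add: norm_mult field_simps)
    moreover have "norm p < norm x" "1 < 1 / norm p" using x p by (auto simp: field_simps)
    moreover have "p * x \<noteq> 1" using px by auto
    ultimately have "x \<in> annulus p" "p * x \<in> annulus p" "x \<noteq> 1" "p * x \<noteq> 1"
      using x by (auto simp: annulus_def norm_mult)
    thus ?thesis using E_per[OF x] EE' by metis
  qed
  ultimately have "E' constant_on annulus p"
    by (rule periodic_holomorphic_constant[OF p])
  hence "E' x = E' y" using x y by (auto simp: constant_on_def)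
  also have "E' y = 0"
    using EE'[OF y] by (simp add: E_def R_def)
  finally have "E x = 0" using EE'[OF x] by simp
  thus ?thesis by (simp add: E_def R_def C_def S_def)
qed

section \<open>Second derivatives at half periods\<close>

text \<open>
  When \<open>x d/dx\<close> is applied twice to \<open>(x - y)\<^sup>2 g(x)\<close>, only the term in which both derivatives fall on the
  square survives at \<open>x = y\<close>. This turns a double zero of the Weierstrass difference into a value of its
  second derivative.
\<close>
lemma second_order_contact:
  fixes F G g :: "complex \<Rightarrow> complex"
  assumes U: "open U" "y \<in> U" "0 \<notin> U" and g: "g holomorphic_on U"
    and F: "\<And>x. x \<in> U \<Longrightarrow> (F has_field_derivative G x / x) (at x)"
    and G: "(G has_field_derivative H / y) (at y)"
    and eq: "\<And>x. x \<in> U \<Longrightarrow> F x - F y = (x - y)^2 * g x"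
  shows "H = 2 * y^2 * g y"
proof -
  have dg: "(g has_field_derivative deriv g x) (at x)" if "x \<in> U" for x
    by (rule holomorphic_derivI[OF g U(1) that])
  have ddg: "(deriv g has_field_derivative deriv (deriv g) y) (at y)"
    by (rule holomorphic_derivI[OF holomorphic_deriv[OF g U(1)] U(1,2)])
  have Gx: "G x = x * (2 * (x - y) * g x + (x - y)^2 * deriv g x)" if x: "x \<in> U" for x
  proof -
    have "((\<lambda>x. F y + (x - y)^2 * g x) has_field_derivative (2 * (x - y) * g x + (x - y)^2 * deriv g x)) (at x)"
      by (rule derivative_eq_intros dg x refl)+ (simp add: algebra_simps)
    hence "(F has_field_derivative (2 * (x - y) * g x + (x - y)^2 * deriv g x)) (at x)"
    proof (rule has_field_derivative_transform_within_open[OF _ U(1) x])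
      show "F y + (z - y)^2 * g z = F z" if "z \<in> U" for z
        using eq[OF that] by (simp add: algebra_simps)
    qed
    from DERIV_unique[OF F[OF x] this] have "G x / x = 2 * (x - y) * g x + (x - y)^2 * deriv g x" .
    moreover have "x \<noteq> 0" using x U(3) by auto
    ultimately show ?thesis by (simp add: field_simps)
  qed
  have "((\<lambda>x. x * (2 * (x - y) * g x + (x - y)^2 * deriv g x)) has_field_derivative (y * (2 * g y))) (at y)"
    by (rule derivative_eq_intros dg ddg U(2) refl)+ simp
  hence "(G has_field_derivative (y * (2 * g y))) (at y)"
    by (rule has_field_derivative_transform_within_open[OF _ U(1,2)]) (simp add: Gx)
  from DERIV_unique[OF G this] have "H / y = y * (2 * g y)" .
  moreover have "y \<noteq> 0" using U by auto
  ultimately show ?thesis by (simp add: field_simps power2_eq_square)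
qed

lemma lambert_inverse_deriv:
  assumes p: "p \<noteq> 0" "norm p < 1" and x: "x \<in> annulus p"
  shows "((\<lambda>x. lambert p k (1 / x)) has_field_derivative - lambert p (Suc k) (1 / x) / x) (at x)"
proof -
  have x0: "x \<noteq> 0" using x p by (auto simp: annulus_def)
  have "norm (1 / x) < 1 / norm p"
    using x p by (auto simp: annulus_def norm_divide intro!: divide_strict_left_mono mult_pos_pos)
  hence 1: "(lambert p k has_field_derivative lambert p (Suc k) (1 / x) / (1 / x)) (at (1 / x))"
    using x0 by (intro lambert_deriv[OF p]) auto
  have 2: "((\<lambda>x. 1 / x) has_field_derivative - 1 / x^2) (at x)"
    using x0 by (auto intro!: derivative_eq_intros simp: power2_eq_square)
  have "lambert p (Suc k) (1 / x) / (1 / x) * (- 1 / x^2) = - lambert p (Suc k) (1 / x) / x"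
    using x0 by (simp add: power2_eq_square)
  with DERIV_chain2[OF 1 2] show ?thesis by simp
qed

text \<open>
  The Lambert series with \<open>n\<^sup>3\<close> arise here: two applications of \<open>x d/dx\<close> to the series with \<open>n\<close>.
\<close>
lemma wp_second_derivative:
  assumes p: "p \<noteq> 0" "norm p < 1" and y: "y \<in> annulus p" "y \<noteq> 1"
    and g: "g holomorphic_on annulus p - {1}"
    and eq: "\<And>x. x \<in> annulus p - {1} \<Longrightarrow> wp p x - wp p y = (x - y)^2 * g x"
  shows "y * (1 + 4 * y + y^2) / (1 - y)^4 + lambert p 3 y + lambert p 3 (1 / y) = 2 * y^2 * g y"
proof (rule second_order_contact[where U = "annulus p - {1}" and F = "wp p" and
    G = "\<lambda>x. x * (1 + x) / (1 - x)^3 + lambert p 2 x - lambert p 2 (1 / x)"])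
  have z: "z \<noteq> 0" "norm z < 1 / norm p" if "z \<in> annulus p" for z
    using that p by (auto simp: annulus_def)
  show "(wp p has_field_derivative (x * (1 + x) / (1 - x)^3 + lambert p 2 x - lambert p 2 (1 / x)) / x) (at x)"
    if "x \<in> annulus p - {1}" for x
    unfolding wp_def [abs_def] diff_divide_distrib add_divide_distrib
    using DERIV_add[OF DERIV_add[OF theta_derivs_rational(1) lambert_deriv[OF p]] lambert_inverse_deriv[OF p], of x 1 1] z[of x] that
    by (simp add: numeral_2_eq_2)
  show "((\<lambda>x. x * (1 + x) / (1 - x)^3 + lambert p 2 x - lambert p 2 (1 / x)) has_field_derivative
          (y * (1 + 4 * y + y^2) / (1 - y)^4 + lambert p 3 y + lambert p 3 (1 / y)) / y) (at y)"
    unfolding add_divide_distrib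
    using DERIV_diff[OF DERIV_add[OF theta_derivs_rational(2) lambert_deriv[OF p]] lambert_inverse_deriv[OF p], of y 2 2] z[of y] y
    by (simp add: eval_nat_numeral)
qed (use p y g eq open_annulus in \<open>auto simp: annulus_def\<close>)

text \<open>
  The half period \<open>-1\<close>. For \<open>y = -1\<close> the two theta factors in \<open>wp_difference\<close> coincide, and
  \<open>x + 1/x + 2 = (x + 1)\<^sup>2 / x\<close>.
\<close>
lemma lambert_at_minus_one:
  assumes p: "p \<noteq> 0" "norm p < 1"
  shows "1 + 16 * lambert p 3 (-1) = theta_core p 1 ^ 4 / theta_core p (-1) ^ 4"
proof -
  define S where "S = theta_core p"
  have m1: "-1 \<in> annulus p" "1 \<in> annulus p" using p by (auto simp: annulus_def field_simps)
  have Snz: "S z \<noteq> 0" if "z \<in> annulus p" for z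
    using theta_core_nonzero[OF p that] by (simp add: S_def)
  define g where "g = (\<lambda>x. S 1 ^ 2 / (4 * S (-1) ^ 2) * S (- x) ^ 2 / ((x - 1)^2 * S x ^ 2))"
  have "(-1) * (1 + 4 * (-1) + (-1)^2) / (1 - (-1))^4 + lambert p 3 (-1) + lambert p 3 (1 / (-1)) = 2 * (-1)^2 * g (-1)"
  proof (rule wp_second_derivative[OF p m1(1)])
    show "g holomorphic_on annulus p - {1}"
      unfolding g_def S_def using p theta_core_nonzero[OF p]
      by (intro holomorphic_intros) (auto simp: annulus_def)
  next
    fix x assume x: "x \<in> annulus p - {1}"
    hence x0: "x \<noteq> 0" "x - 1 \<noteq> 0" using p by (auto simp: annulus_def)
    have e: "x + 1 / x - (-1 + 1 / (-1)) = (x - (-1))^2 / x" "x + 1 / x - 2 = (x - 1)^2 / x"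
      using x0 by (simp_all add: field_simps power2_eq_square)
    have "wp p x - wp p (-1) =  S 1 ^ 2 / ((2 - (-1 + 1 / (-1))) * S (-1) ^ 2) *
           (x + 1 / x - (-1 + 1 / (-1))) * S (x * (-1)) * S (x / (-1)) / ((x + 1 / x - 2) * S x ^ 2)"
      unfolding S_def by (rule wp_difference[OF p m1(1)]) (use x in auto)
    also have "\<dots> = (x - (-1))^2 * g x"
      unfolding e g_def using x0 by (simp add: power2_eq_square)
    finally show "wp p x - wp p (-1) = (x - (-1))^2 * g x" .
  qed auto
  hence "1 + 16 * lambert p 3 (-1) = 16 * g (-1)" by (simp add: field_simps)
  also have "\<dots> = S 1 ^ 4 / S (-1) ^ 4"
    using Snz[OF m1(1)] by (simp add: g_def field_simps flip: power_add)
  finally show ?thesis by (simp add: S_def)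
qed

text \<open>
  The half period \<open>q\<close> for the period \<open>p = q\<^sup>2\<close>. The arguments \<open>x q\<close> and \<open>x / q\<close> of the two theta factors
  differ by the factor \<open>p\<close>, so \<open>theta_core_shift\<close> supplies the second zero at \<open>x = q\<close>.
\<close>
lemma lambert_at_half_period:
  assumes q: "q \<noteq> 0" "norm q < 1"
  shows "q * (1 + 4 * q + q^2) / (1 - q)^4 + lambert (q^2) 3 q + lambert (q^2) 3 (1 / q) =
           2 * q * theta_core (q^2) 1 ^ 4 / ((1 - q) * theta_core (q^2) q) ^ 4"
proof -
  define p where "p = q^2"
  have p: "p \<noteq> 0" "norm p < 1"
    using q by (auto simp: p_def norm_power power_less_one_iff)
  have "norm q * norm q < norm q * 1" using q by (intro mult_strict_left_mono) auto
  moreover have "1 < 1 / norm p" using p by (simp add: divide_simps)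
  moreover have "norm p = norm q * norm q" by (simp add: p_def norm_mult power2_eq_square)
  ultimately have m1: "q \<in> annulus p" "1 \<in> annulus p"
    using q p(2) by (auto simp only: annulus_def mem_Collect_eq norm_one)
  have q1: "q \<noteq> 1" "1 - q \<noteq> 0" using q by auto
  define S where "S = theta_core p"
  have Snz: "S z \<noteq> 0" if "z \<in> annulus p" for z
    using theta_core_nonzero[OF p that] by (simp add: S_def)
  have Y: "2 - (q + 1 / q) = - ((1 - q)^2 / q)"
    using q by (simp add: field_simps power2_eq_square)
  define C where "C = S 1 ^ 2 / ((2 - (q + 1 / q)) * S q ^ 2)"
  define g where "g = (\<lambda>x. - (C * S (x / q) ^ 2) / (q * x * (x - 1)^2 * S x ^ 2))"
  have "q * (1 + 4 * q + q^2) / (1 - q)^4 + lambert p 3 q + lambert p 3 (1 / q) = 2 * q^2 * g q"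
  proof (rule wp_second_derivative[OF p m1(1) q1(1)])
    show "g holomorphic_on annulus p - {1}"
      unfolding g_def S_def using p q theta_core_nonzero[OF p]
      by (intro holomorphic_intros) (auto simp: annulus_def)
  next
    fix x assume x: "x \<in> annulus p - {1}"
    hence x0: "x \<noteq> 0" "x - 1 \<noteq> 0" using p by (auto simp: annulus_def)
    have X: "x + 1 / x - 2 = (x - 1)^2 / x"
      using x0 by (simp add: field_simps power2_eq_square)
    have "p * (x / q) = x * q" using q by (simp add: p_def power2_eq_square)
    hence sh: "(1 - x * q) * S (x * q) = (1 - q / x) * S (x / q)"
      using theta_core_shift[OF p, of "x / q"] x0 q by (simp add: S_def)
    have "x + 1 / x - (q + 1 / q) = - ((x - q) / (x * q)) * (1 - x * q)"
      using x0 q by (simp add: field_simps)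
    hence "(x + 1 / x - (q + 1 / q)) * S (x * q) = - ((x - q) / (x * q)) * ((1 - x * q) * S (x * q))"
      by simp
    also have "\<dots> = - ((x - q)^2 / (q * x^2)) * S (x / q)"
      unfolding sh using x0 q by (simp add: field_simps power2_eq_square)
    finally have num: "(x + 1 / x - (q + 1 / q)) * S (x * q) = - ((x - q)^2 / (q * x^2)) * S (x / q)" .
    have "wp p x - wp p q = C * (x + 1 / x - (q + 1 / q)) * S (x * q) * S (x / q) / ((x + 1 / x - 2) * S x ^ 2)"
      unfolding S_def C_def by (rule wp_difference[OF p m1(1) q1(1)]) (use x in auto)
    also have "\<dots> = C * ((x + 1 / x - (q + 1 / q)) * S (x * q)) * S (x / q) / ((x + 1 / x - 2) * S x ^ 2)"
      by (simp only: mult.assoc)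
    also have "\<dots> = (x - q)^2 * g x"
      unfolding num X g_def using x0 q by (simp add: power2_eq_square mult_ac)
    finally show "wp p x - wp p q = (x - q)^2 * g x" .
  qed
  also have "2 * q^2 * g q = 2 * q * S 1 ^ 4 / ((1 - q) * S q) ^ 4"
    unfolding g_def C_def Y using q q1 Snz[OF m1(1)]
    by (simp add: power2_commute[of q 1] power_mult_distrib) (simp add: eval_nat_numeral mult_ac)
  finally show ?thesis by (simp add: S_def p_def)
qed

section \<open>The Eisenstein series of weight 4\<close>

text \<open>
  The right-hand side is \<open>\<phi>(-q)\<^sup>8\<close>.
\<close>
lemma lambert_minus_one_product:
  assumes q: "q \<noteq> 0" "norm q < 1"
  shows "1 + 16 * lambert q 3 (-1) = euler_prod q ^ 16 / euler_prod (q^2) ^ 8"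
proof -
  have "theta_core q 1 = euler_prod q ^ 2"
    by (simp add: theta_core_def euler_prod_def power2_eq_square)
  moreover have "theta_core q (-1) = (euler_prod (q^2) / euler_prod q) ^ 2"
    using qpoch_minus_self[OF q(2)] by (simp add: theta_core_def power2_eq_square)
  moreover have "euler_prod q \<noteq> 0" by (rule euler_prod_nonzero[OF q(2)])
  ultimately show ?thesis
    unfolding lambert_at_minus_one[OF q] by (simp add: power_divide flip: power_mult power_add)
qed

text \<open>
  The right-hand side is \<open>2 q \<psi>(q)\<^sup>8\<close>, and the left-hand side is \<open>2 \<Sum> n\<^sup>3 q^n / (1 - q^(2n))\<close>, left in the form
  in which the second derivative produces it.
\<close>
lemma lambert_half_period_product:
  assumes q: "q \<noteq> 0" "norm q < 1"
  shows "q * (1 + 4 * q + q^2) / (1 - q)^4 + lambert (q^2) 3 q + lambert (q^2) 3 (1 / q) =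
           2 * q * euler_prod (q^2) ^ 16 / euler_prod q ^ 8"
proof -
  have q2: "norm (q^2) < 1" by (rule norm_power_less_one) (use q in auto)
  have "theta_core (q^2) 1 = euler_prod (q^2) ^ 2"
    by (simp add: theta_core_def euler_prod_def power2_eq_square)
  moreover have "(1 - q) * theta_core (q^2) q = (euler_prod q / euler_prod (q^2)) ^ 2"
  proof -
    have "q^2 / q = q" using q by (simp add: power2_eq_square)
    hence "(1 - q) * theta_core (q^2) q = ((1 - q) * qpoch (q^2 * q) (q^2)) * qpoch q (q^2)"
      by (simp add: theta_core_def)
    also have "\<dots> = qpoch q (q^2) ^ 2"
      unfolding qpoch_unfold[OF q2, of q, symmetric] by (simp only: power2_eq_square)
    finally show ?thesis unfolding qpoch_odd[OF q(2)] .
  qed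
  moreover have "euler_prod q \<noteq> 0" by (rule euler_prod_nonzero[OF q(2)])
  ultimately show ?thesis
    unfolding lambert_at_half_period[OF q] by (simp add: power_divide flip: power_mult power_add)
qed

text \<open>
  With \<open>a n = n\<^sup>3 q^(2n) / (1 - q^(2n))\<close>, the \<open>n\<close>-th terms of the two Lambert series above combine to \<open>- 2 a n\<close>
  for odd \<open>n\<close> and to \<open>- 2 a n + 32 a (n/2)\<close> for even \<open>n\<close>. Summation over \<open>n\<close> gives \<open>30 \<Sum> a n\<close>.
\<close>
theorem eisenstein4_eta:
  assumes q: "q \<noteq> 0" "norm q < 1"
  shows "1 + 240 * lambert (q^2) 3 1 =
           euler_prod q ^ 16 / euler_prod (q^2) ^ 8 + 16 * q * euler_prod (q^2) ^ 16 / euler_prod q ^ 8"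
proof -
  define p where "p = q^2"
  have p: "p \<noteq> 0" "norm p < 1"
    using q norm_power_less_one[of q 2] by (auto simp: p_def)
  have "norm q * norm q < norm q * 1" using q by (intro mult_strict_left_mono) auto
  hence "norm p < norm q" by (simp add: p_def norm_mult power2_eq_square)
  hence bounds: "1 < 1 / norm q" "1 < 1 / norm p" "norm (1 / q) < 1 / norm p"
    using q p by (auto simp: norm_divide intro!: divide_strict_left_mono)
  hence "norm q < 1 / norm p" using q(2) by linarith
  note bounds = bounds this
  define a where "a = (\<lambda>n. of_nat n ^ 3 * (p ^ n / (1 - p ^ n)))"
  define t where "t = (\<lambda>n. of_nat n ^ 3 * (q ^ n / (1 - q ^ n)) * (-1) ^ n)"
  define v where "v = (\<lambda>n. of_nat n ^ 3 * q ^ n + of_nat n ^ 3 * (p ^ n / (1 - p ^ n)) * q ^ n +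
                         of_nat n ^ 3 * (p ^ n / (1 - p ^ n)) * (1 / q) ^ n)"
  have a: "a sums lambert p 3 1"
    using summable_sums[OF summable_lambert[OF p, of 1 3]] bounds by (simp add: a_def lambert_def)
  have t: "t sums lambert q 3 (-1)"
    using summable_sums[OF summable_lambert[OF q, of "-1" 3]] bounds by (simp add: t_def lambert_def)
  have v: "v sums (2 * q * euler_prod (q^2) ^ 16 / euler_prod q ^ 8)"
    unfolding lambert_half_period_product[OF q, symmetric] v_def
    using summable_sums[OF summable_lambert[OF p, of q 3]] summable_sums[OF summable_lambert[OF p, of "1 / q" 3]] bounds
    by (intro sums_add sums_n3_power) (use q in \<open>auto simp: lambert_def p_def\<close>)
  \<comment> \<open>the series \<open>a\<close> spread out over the even indices\<close>
  define b where "b = (\<lambda>n. if even n then a (n div 2) else 0)"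
  have "(\<lambda>n. b (2 * n)) sums lambert p 3 1 \<longleftrightarrow> b sums lambert p 3 1"
    by (rule sums_mono_reindex) (auto simp: strict_mono_def b_def elim: evenE)
  hence b: "b sums lambert p 3 1" using a by (simp add: b_def)
  have "2 * t n + v n = - 2 * a n + 32 * b n" for n
  proof (cases "n = 0")
    case False
    define x where "x = q ^ n"
    have "norm x < 1" unfolding x_def by (rule norm_power_less_one) (use q False in auto)
    hence x1: "x \<noteq> 1" "x \<noteq> -1" by auto
    have x0: "x \<noteq> 0" using q by (simp add: x_def)
    have pn: "p ^ n = x^2" by (simp add: p_def x_def mult.commute flip: power_mult)
    have f: "1 - x^2 = (1 - x) * (1 + x)" by (simp add: algebra_simps power2_eq_square)
    have nz: "1 - x \<noteq> 0" "1 + x \<noteq> 0" using x1 by (auto simp: add_eq_0_iff)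
    have vn: "v n = of_nat n ^ 3 * (2 * x / ((1 - x) * (1 + x)))"
      unfolding v_def pn f using nz x0
      by (simp add: x_def [symmetric] power_one_over) (simp add: divide_simps, simp add: algebra_simps power2_eq_square)
    have an: "a n = of_nat n ^ 3 * (x^2 / ((1 - x) * (1 + x)))"
      by (simp add: a_def pn f)
    show ?thesis
    proof (cases "even n")
      case True
      then obtain k where k: "n = 2 * k" by (elim evenE)
      have "p ^ k = x" by (simp add: p_def x_def k flip: power_mult)
      hence "b n = (of_nat n / 2) ^ 3 * (x / (1 - x))"
        by (simp add: b_def k a_def)
      moreover have "t n = of_nat n ^ 3 * (x / (1 - x))"
        using True by (simp add: t_def x_def)
      ultimately show ?thesis
        unfolding vn an using nz by (simp add: power_divide) (simp add: divide_simps, simp add: algebra_simps power2_eq_square)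
    next
      case odd: False
      hence bt: "b n = 0" "t n = - (of_nat n ^ 3 * (x / (1 - x)))"
        by (simp_all add: b_def t_def x_def)
      show ?thesis
        unfolding vn an bt using nz by (simp add: divide_simps) (simp add: algebra_simps power2_eq_square)
    qed
  qed (simp add: t_def v_def a_def b_def)
  hence "(\<lambda>n. - 2 * a n + 32 * b n) sums (2 * lambert q 3 (-1) + 2 * q * euler_prod (q^2) ^ 16 / euler_prod q ^ 8)"
    using sums_add[OF sums_mult[OF t, of 2] v] by simp
  moreover have "(\<lambda>n. - 2 * a n + 32 * b n) sums (- 2 * lambert p 3 1 + 32 * lambert p 3 1)"
    by (intro sums_add sums_mult a b)
  ultimately have "2 * lambert q 3 (-1) + 2 * q * euler_prod (q^2) ^ 16 / euler_prod q ^ 8 = 30 * lambert p 3 1"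
    using sums_unique2 by force
  hence "8 * (2 * lambert q 3 (-1) + 2 * q * euler_prod (q^2) ^ 16 / euler_prod q ^ 8) = 8 * (30 * lambert p 3 1)"
    by (simp only:)
  hence "1 + 240 * lambert p 3 1 = (1 + 16 * lambert q 3 (-1)) + 16 * q * euler_prod (q^2) ^ 16 / euler_prod q ^ 8"
    by (simp add: distrib_left mult.assoc)
  thus ?thesis unfolding lambert_minus_one_product[OF q] by (simp add: p_def)
qed

section \<open>The j-invariant as a function of u\<close>

lemma nome_pow_multiple: "nome_pow r (of_nat k * \<tau>) = nome_pow r \<tau> ^ k"
  by (simp add: nome_pow_def mult_ac flip: exp_of_nat_mult)

lemma nome_pow_24th_root: "nome_pow (1 / 24) \<tau> ^ 24 = nome \<tau>"
  by (simp add: nome_pow_def mult_ac flip: exp_of_nat_mult)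

lemma norm_nome_less_one: "Im \<tau> > 0 \<Longrightarrow> norm (nome \<tau>) < 1"
  by (simp add: nome_pow_def)

lemma dedekind_eta_multiple:
  "dedekind_eta (of_nat k * \<tau>) = nome_pow (1 / 24) \<tau> ^ k * euler_prod (nome \<tau> ^ k)"
  by (simp add: dedekind_eta_def nome_pow_multiple euler_prod_def qpoch_def)

theorem theorem6p1:
  fixes \<tau> u :: complex
  assumes "Im \<tau> > 0"
    and "u = u_fun \<tau>"
  shows "j_invariant (2 * \<tau>) =
    ((1 + 6 * u^2 - 2 * u^3) ^ 3 * Q u ^ 3) /
    (u^2 * (1 - 2 * u) ^ 9 * (1 + u) ^ 18 * (1 - u + u^2) ^ 2 * (1 + 2 * u + 4 * u^2))"
proof -
  define q where "q = nome \<tau>"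
  define z where "z = nome_pow (1 / 24) \<tau>"
  have q: "norm q < 1" "q \<noteq> 0"
    using norm_nome_less_one[OF assms(1)] by (simp_all add: q_def) (simp add: nome_pow_def)
  have z24: "z ^ 24 = q" unfolding z_def q_def by (rule nome_pow_24th_root)
  have z0: "z \<noteq> 0" using z24 q by auto
  have eta: "dedekind_eta (of_nat k * \<tau>) = z ^ k * euler_prod (q ^ k)" for k
    unfolding z_def q_def by (rule dedekind_eta_multiple)
  have nz: "euler_prod (q ^ n) \<noteq> 0" if "n > 0" for n
    using euler_prod_nonzero[OF norm_power_less_one[OF q(1) that]] .
  have u: "u = level18_hauptmodul q"
  proof -
    have "u = (z ^ 3 * (z ^ 18) ^ 3 / (z ^ 6 * (z ^ 9) ^ 3)) *
              (euler_prod (q^3) * euler_prod (q^18) ^ 3 / (euler_prod (q^6) * euler_prod (q^9) ^ 3))"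
      unfolding assms(2) u_fun_def eta[of 3, simplified] eta[of 18, simplified] eta[of 6, simplified] eta[of 9, simplified]
      by (simp only: power_mult_distrib times_divide_times_eq mult_ac)
    also have "z ^ 3 * (z ^ 18) ^ 3 / (z ^ 6 * (z ^ 9) ^ 3) = q"
      using z0 by (simp add: z24 [symmetric] divide_simps flip: power_mult power_add)
    finally show ?thesis by (simp add: level18_hauptmodul_def)
  qed
  define h where "h = euler_prod q ^ 24 / (q * euler_prod (q^2) ^ 24)"
  have E: "euler_prod q \<noteq> 0" "euler_prod (q^2) \<noteq> 0" using nz[of 1] nz[of 2] by auto
  have h0: "h \<noteq> 0" using q E by (simp add: h_def)
  have j: "j_invariant (2 * \<tau>) = (h + 16) ^ 3 / h"
  proof -
    have n2: "nome (2 * \<tau>) = q^2"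
      using nome_pow_multiple[of 1 2 \<tau>] by (simp add: q_def)
    have "norm (q^2) < 1" "q^2 \<noteq> 0" using norm_power_less_one[OF q(1), of 2] q by auto
    moreover have "1 < 1 / norm (q^2)" using calculation by (simp add: divide_simps)
    ultimately have "summable (\<lambda>n. of_nat n ^ 3 * ((q^2) ^ n / (1 - (q^2) ^ n)) * 1 ^ n)"
      by (intro summable_lambert) auto
    from suminf_split_head[OF this]
    have "lambert (q^2) 3 1 = (\<Sum>n. of_nat (Suc n) ^ 3 * ((q^2) ^ Suc n / (1 - (q^2) ^ Suc n)))"
      unfolding lambert_def by simp
    hence "(\<Sum>n. of_nat (Suc n) ^ 3 * nome (2 * \<tau>) ^ Suc n / (1 - nome (2 * \<tau>) ^ Suc n)) = lambert (q^2) 3 1"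
      unfolding n2 by (simp only: times_divide_eq_right)
    moreover have "dedekind_eta (2 * \<tau>) powi (-24) = inverse (q^2 * euler_prod (q^2) ^ 24)"
    proof -
      have "(z^2) ^ 24 = q^2" by (simp add: z24 [symmetric] flip: power_mult)
      thus ?thesis using eta[of 2] by (simp add: power_int_minus power_mult_distrib)
    qed
    ultimately have "j_invariant (2 * \<tau>) = (1 + 240 * lambert (q^2) 3 1) ^ 3 / (q^2 * euler_prod (q^2) ^ 24)"
      unfolding j_invariant_def by (simp add: divide_inverse mult.commute)
    also have "1 + 240 * lambert (q^2) 3 1 = (h + 16) * (q * euler_prod (q^2) ^ 16 / euler_prod q ^ 8)"
      unfolding eisenstein4_eta[OF q(2,1)] h_def using E q
      by (simp add: divide_simps, simp add: eval_nat_numeral algebra_simps)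
    also have "((h + 16) * (q * euler_prod (q^2) ^ 16 / euler_prod q ^ 8)) ^ 3 / (q^2 * euler_prod (q^2) ^ 24) = 
               (h + 16) ^ 3 * ((q * euler_prod (q^2) ^ 16 / euler_prod q ^ 8) ^ 3 / (q^2 * euler_prod (q^2) ^ 24))"
      by (subst power_mult_distrib) (rule times_divide_eq_right [symmetric])
    also have "(q * euler_prod (q^2) ^ 16 / euler_prod q ^ 8) ^ 3 / (q^2 * euler_prod (q^2) ^ 24) = 1 / h"
      unfolding h_def using E q
      by (simp add: power_mult_distrib power_divide divide_simps flip: power_mult)
         (simp add: eval_nat_numeral mult_ac)
    finally show ?thesis by simp
  qed
  \<comment> \<open>Clearing denominators in \<open>h = A / B\<close>; the factorisations of \<open>1 + u\<^sup>3\<close> and \<open>1 - 8u\<^sup>3\<close> account for the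
      exponents 9 and 18 and the quadratic factors.\<close>
  define A B where "A = (1 - 2 * u) ^ 8 * (1 - 8 * u^3)" and "B = u * (1 + u) ^ 8 * (1 + u^3)"
  have AB: "A = h * B" "B \<noteq> 0"
    using eta_quotient_hauptmodul[OF q] by (simp_all add: A_def B_def h_def u)
  have num: "A + 16 * B = (1 + 6 * u^2 - 2 * u^3) * Q u"
    unfolding A_def B_def Q_def by algebra
  have den: "B^2 * A = u^2 * (1 - 2 * u) ^ 9 * (1 + u) ^ 18 * (1 - u + u^2) ^ 2 * (1 + 2 * u + 4 * u^2)"
  proof -
    have "1 + u^3 = (1 + u) * (1 - u + u^2)" "1 - 8 * u^3 = (1 - 2 * u) * (1 + 2 * u + 4 * u^2)"
      by algebra+
    thus ?thesis unfolding A_def B_def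
      by (simp add: power_mult_distrib mult_ac flip: power_mult) (simp add: eval_nat_numeral mult_ac)
  qed
  have "(h + 16) ^ 3 / h = (A + 16 * B) ^ 3 / (B^2 * A)"
  proof -
    have "A + 16 * B = (h + 16) * B" by (simp add: AB(1) algebra_simps)
    thus ?thesis
      using AB(2) h0 by (simp add: AB(1) power_mult_distrib) (simp add: divide_simps eval_nat_numeral)
  qed
  thus ?thesis
    unfolding j num den by (simp only: power_mult_distrib)
qed

end
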